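(* Let $t\ge 2$ and $1\le m<t$ be integers. Then for all $x\in\mathbb{C}\setminus\{0\}$, $$f_{t,m}(x) = \frac{q^{-\frac{t}{4}}}{(q)^3_{\infty}} \sum_{k \bmod 2t}(-1)^k q^{\frac{(k+t)^2}{4t}}\,\theta_{t+k,m+k} \sum_{\substack{r,l \in \mathbb{Z}\\ l\equiv k \ (\mathrm{mod}\ 2t)}} \mathrm{sg}(r,l)(-1)^r q^{\frac{r^2}{2}+rl+\frac{2t-1}{4t}l^2+\frac{1}{2}r}x^{-r},$$ where $k$ runs over a complete system of residues modulo $2t$.
   Context: Throughout, $q\in\mathbb{C}$ with $0<|q|<1$; fractional powers of $q$ are taken consistently: fix $\tau$ with $q=e^{2\pi i\tau}$ and put $q^{\alpha}=e^{2\pi i\alpha\tau}$. $(x)_\infty=(x;q)_\infty=\prod_{i\ge0}(1-xq^i)$, so $(q)_\infty=\prod_{i\ge 1}(1-q^i)$. $\Theta(x;q)=(x)_\infty(q/x)_\infty(q)_\infty=\sum_{n\in\mathbb{Z}}(-1)^nq^{\binom n2}x^n$. $\mathrm{sg}(r)=1$ if $r\ge0$ and $-1$ if $r<0$; $\mathrm{sg}(r,s)=\frac{\mathrm{sg}(r)+\mathrm{sg}(s)}{2}$. For integers $t\geq 1$, $m$ define $$g_{t,m}(x) = \sum_{\substack{r,s\in\mathbb{Z}\\ r\equiv s\ (\mathrm{mod}\ 2)}} \mathrm{sg}(r,s) \frac{(-1)^{\frac{r-s}{2}}q^{\frac{r^2}{8}+\frac{4t-1}{4}rs+\frac{s^2}{8}+\frac{4t-1-2m}{4}r+\frac{1+2m}{4}s}}{1-xq^{\frac{r+s}{2}}},\qquad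 f_{t,m}(x)=\frac{\Theta(x;q)}{(q)_\infty^3}g_{t,m}(x),$$ where $f_{t,m}$ is regarded as a function on $\mathbb{C}\setminus\{0\}$ (it has no poles; values at integer powers of $q$ are given by the holomorphic extension). For the fixed $t$ and $p,m\in\mathbb{Z}$ define $$\theta_{p,m} = \sum_{\substack{r,s\in\mathbb{Z}\\ r\equiv s\ (\mathrm{mod}\ 2)}} \mathrm{sg}(r,s) (-1)^{\frac{r-s}{2}}q^{\frac{r^2}{8}+\frac{4t-1}{4}rs+\frac{s^2}{8}+\frac{4p-1-2m}{4}r+\frac{1+2m}{4}s}.$$ *)

theory Defs
  imports "HOL-Complex_Analysis.Complex_Analysis" "HOL-Number_Theory.Cong"
begin

text \<open>Every power of \<open>q\<close>, integral or fractional, is taken through a fixed \<open>\<tau>\<close>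
  with \<open>q = exp (2 \<pi> i \<tau>)\<close>; in particular \<open>q = qpow \<tau> 1\<close>.\<close>

definition qpow :: "complex \<Rightarrow> real \<Rightarrow> complex" where
  "qpow \<tau> \<alpha> = exp (2 * of_real pi * \<i> * of_real \<alpha> * \<tau>)"

definition qpoch :: "complex \<Rightarrow> complex \<Rightarrow> complex" where
  "qpoch x q = (\<Prod>i. 1 - x * q ^ i)"

definition Theta :: "complex \<Rightarrow> complex \<Rightarrow> complex" where
  "Theta x q = qpoch x q * qpoch (q / x) q * qpoch q q"

text \<open>Not the library's \<^const>\<open>sgn\<close>: here \<open>sg 0 = 1\<close>.\<close>

definition sg :: "int \<Rightarrow> complex" where
  "sg r = (if r \<ge> 0 then 1 else - 1)"

definition sg2 :: "int \<Rightarrow> int \<Rightarrow> complex" where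
  "sg2 r s = (sg r + sg s) / 2"

text \<open>The double series below converge absolutely, so unordered summation is meant.
  On the index sets with \<open>r \<equiv> s (mod 2)\<close> the integer division \<open>(r - s) div 2\<close> is exact.\<close>

definition g_fun :: "complex \<Rightarrow> int \<Rightarrow> int \<Rightarrow> complex \<Rightarrow> complex" where
  "g_fun \<tau> t m x =
    (\<Sum>\<^sub>\<infinity>(r, s) \<in> {(r, s). [r = s] (mod 2)}.
       sg2 r s * ((- 1) powi ((r - s) div 2) *
         qpow \<tau> (of_int r ^ 2 / 8 + (4 * of_int t - 1) / 4 * of_int r * of_int s + of_int s ^ 2 / 8
                  + (4 * of_int t - 1 - 2 * of_int m) / 4 * of_int r
                  + (1 + 2 * of_int m) / 4 * of_int s))
       / (1 - x * qpow \<tau> ((of_int r + of_int s) / 2)))"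

definition f_raw :: "complex \<Rightarrow> int \<Rightarrow> int \<Rightarrow> complex \<Rightarrow> complex" where
  "f_raw \<tau> t m x =
    Theta x (qpow \<tau> 1) / qpoch (qpow \<tau> 1) (qpow \<tau> 1) ^ 3 * g_fun \<tau> t m x"

text \<open>At an integer power of \<open>q\<close> the series for \<open>g\<close> has a term with vanishing denominator
  (which \<open>f_raw\<close> would silently evaluate by \<open>z / 0 = 0\<close>); there the value of \<open>f\<close> is that of
  the holomorphic extension.\<close>

definition f_fun :: "complex \<Rightarrow> int \<Rightarrow> int \<Rightarrow> complex \<Rightarrow> complex" where
  "f_fun \<tau> t m x =
    (if \<exists>n::int. x = qpow \<tau> (of_int n) then remove_sings (f_raw \<tau> t m) x else f_raw \<tau> t m x)"

definition theta :: "complex \<Rightarrow> int \<Rightarrow> int \<Rightarrow> int \<Rightarrow> complex" where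
  "theta \<tau> t p m =
    (\<Sum>\<^sub>\<infinity>(r, s) \<in> {(r, s). [r = s] (mod 2)}.
       sg2 r s * (- 1) powi ((r - s) div 2) *
         qpow \<tau> (of_int r ^ 2 / 8 + (4 * of_int t - 1) / 4 * of_int r * of_int s + of_int s ^ 2 / 8
                  + (4 * of_int p - 1 - 2 * of_int m) / 4 * of_int r
                  + (1 + 2 * of_int m) / 4 * of_int s))"

definition complete_residue_system :: "int \<Rightarrow> int set \<Rightarrow> bool" where
  "complete_residue_system n K \<longleftrightarrow> (\<forall>a. \<exists>!k. k \<in> K \<and> [k = a] (mod n))"

end

theory Submission
  imports Defs
begin

text \<open>
  Both sides of the identity, multiplied by \<open>(q)\<^sub>\<infinity>\<^sup>3\<close>, are holomorphic functions of \<open>x\<close> on the punctured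
  plane, and they satisfy the same \<open>q\<close>-difference equation up to an error so small that no nonzero
  holomorphic function can produce it.

  With \<open>n = (r + s) / 2\<close> and \<open>j = (r - s) / 2\<close> the sum \<open>g\<close> becomes a sum of Appell type
  \<open>\<Sum>\<^sub>n a\<^sub>n / (1 - x q\<^sup>n)\<close>, where \<open>a\<^sub>n\<close> is \<open>\<plusminus> q\<^bsup>tn(n+1)\<^esup>\<close> times a finite sum over the \<open>j\<close> in a symmetric
  interval whose length grows with \<open>\<bar>n\<bar>\<close>. Passing from \<open>n - 1\<close> to \<open>n\<close> adds two boundary terms
  \<open>e\<^sub>n\<close>, so \<open>a\<^sub>n = e\<^sub>n + q\<^bsup>2tn\<^esup> a\<^bsub>n-1\<^esub>\<close>. Put \<open>\<Phi> l = \<Sum>\<^sub>n a\<^sub>n q\<^bsup>ln\<^esup>\<close>, which is \<open>\<theta>\<close> at \<open>(t + l, m + l)\<close>. Since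
  \<open>q\<^bsup>2tn\<^esup>\<close> and \<open>x\<^bsup>-2t\<^esup>\<close> differ by a multiple of \<open>1 - x q\<^sup>n\<close>, the recurrence turns into
  \<open>g(q x) = x\<^bsup>2t\<^esup> g(x) + \<Sum>\<^bsub>0\<le>i<2t\<^esub> x\<^sup>i \<Phi>(i - 2t) - x\<^bsup>2t\<^esup> \<Sum>\<^sub>n e\<^sub>n / (1 - x q\<^sup>n)\<close>. The last sum, multiplied by
  \<open>\<Theta>(x)\<close>, is \<open>x\<^bsup>-m\<^esup> + x\<^bsup>m-2t+1\<^esup>\<close> times a function invariant under \<open>x \<mapsto> q x\<close> and holomorphic, hence
  bounded. With \<open>N = 2t - 1\<close> this gives (\<open>f_functional_equation\<close>)
  \<open>f(q x) + x\<^sup>N f(x) = - \<Theta>(x) / (x (q)\<^sub>\<infinity>\<^sup>3) \<Sum>\<^sub>i x\<^sup>i \<Phi>(i - 2t)\<close> up to an error \<open>O(|x| + |x|\<^sup>N)\<close>.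

  On the other side \<open>\<psi> l = (-1)\<^sup>l q\<^bsup>l^2/4t + l/2\<^esup> \<Phi> l\<close> has period \<open>2t\<close>, so the sum over residue classes
  collapses to one sum over all \<open>(r, l)\<close> weighted by \<open>\<psi> l\<close> (\<open>residue_class_sum\<close>). The substitution
  \<open>(r, l) \<mapsto> (r + N, l - 2t)\<close>, followed by multiplication with \<open>- x\<^sup>N\<close>, turns each summand at \<open>x\<close> into the
  one at \<open>q x\<close>; it changes the cone of summation by two strips. The strip of \<open>2t\<close> values of \<open>l\<close> is summed over \<open>r\<close> by the Jacobi triple product
  and yields the same theta expression as above; the strip of \<open>N\<close> values of \<open>r\<close> contributes powers
  \<open>x, \<dots>, x\<^sup>N\<close> only (\<open>weighted_sum_functional_equation\<close>).

  Hence the difference \<open>H\<close> of the two sides satisfies \<open>|H(q x) + x\<^sup>N H(x)| \<le> C (|x| + |x|\<^sup>N)\<close>. Such an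
  inequality keeps \<open>H\<close> bounded when \<open>x\<close> is moved towards \<open>0\<close> or \<open>\<infinity>\<close> by powers of \<open>q\<close>; by Liouville \<open>H\<close>
  is constant, and \<open>x \<rightarrow> 0\<close> shows that the constant is \<open>0\<close> (\<open>q_difference_unique\<close>).
\<close>

section \<open>Gaussian sums and holomorphy of infinite sums\<close>

lemma summable_on_int_exp_abs: "(\<lambda>n::int. exp (- \<bar>of_int n\<bar> :: real)) summable_on UNIV"
proof -
  let ?f = "\<lambda>n::int. exp (- \<bar>of_int n\<bar> :: real)"
  have nat: "(\<lambda>n::nat. exp (- real n)) summable_on UNIV"
    unfolding summable_on_UNIV_nonneg_real_iff[OF exp_ge_zero]
    using summable_geometric[of "exp (-1::real)"]
    by (simp add: exp_of_nat_mult[symmetric])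
  have "?f summable_on range int"
    using nat by (subst summable_on_reindex) (auto simp: o_def inj_on_def)
  moreover have "?f summable_on range (\<lambda>n. - int n)"
    using nat by (subst summable_on_reindex) (auto simp: o_def inj_on_def)
  ultimately have "?f summable_on (range int \<union> range (\<lambda>n. - int n))"
    by (rule summable_on_union)
  moreover have "range int \<union> range (\<lambda>n. - int n) = UNIV"
    by (metis (no_types, lifting) UNIV_eq_I UnI1 UnI2 int_cases2 rangeI)
  ultimately show ?thesis by simp
qed

text \<open>Completing the square bounds the exponent by a constant minus \<open>\<bar>n\<bar>\<close>.\<close>

lemma summable_on_gauss:
  fixes a b :: real
  assumes "a > 0"
  shows "(\<lambda>n::int. exp (- a * (of_int n)\<^sup>2 + b * \<bar>of_int n\<bar>)) summable_on UNIV"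
proof (rule summable_on_comparison_test)
  define C where "C = (b + 1)\<^sup>2 / (4 * a)"
  show "(\<lambda>n::int. exp C * exp (- \<bar>of_int n\<bar> :: real)) summable_on UNIV"
    by (intro summable_on_cmult_right summable_on_int_exp_abs)
  show "exp (- a * (of_int n)\<^sup>2 + b * \<bar>of_int n\<bar>) \<le> exp C * exp (- \<bar>of_int n\<bar> :: real)" for n :: int
  proof -
    let ?x = "\<bar>of_int n\<bar> :: real"
    have "a * ?x\<^sup>2 - (b + 1) * ?x + C = a * (?x - (b + 1) / (2 * a))\<^sup>2"
      using assms by (simp add: C_def power2_eq_square field_simps)
    also have "\<dots> \<ge> 0" using assms by simp
    finally have "- a * (of_int n)\<^sup>2 + b * ?x \<le> C - ?x" by (simp add: algebra_simps)
    then have "exp (- a * (of_int n)\<^sup>2 + b * ?x) \<le> exp (C - ?x)" by simp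
    then show ?thesis by (simp add: exp_diff exp_minus field_simps)
  qed
qed auto

lemma summable_on_gauss2:
  fixes a b :: real
  assumes "a > 0"
  shows "(\<lambda>(r::int, l::int). exp (- a * ((of_int r)\<^sup>2 + (of_int l)\<^sup>2) + b * (\<bar>of_int r\<bar> + \<bar>of_int l\<bar>)))
    summable_on UNIV"
proof -
  let ?g = "\<lambda>n::int. exp (- a * (of_int n)\<^sup>2 + b * \<bar>of_int n\<bar>)"
  let ?f = "\<lambda>(r::int, l::int). ?g r * ?g l"
  have "?f summable_on (UNIV \<times> UNIV)"
  proof (rule summable_on_SigmaI)
    show "((\<lambda>y. ?f (x, y)) has_sum (?g x * infsum ?g UNIV)) UNIV" for x
      unfolding prod.case by (intro has_sum_cmult_right has_sum_infsum summable_on_gauss assms)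
    show "(\<lambda>x. ?g x * infsum ?g UNIV) summable_on UNIV"
      by (intro summable_on_cmult_left summable_on_gauss assms)
  qed auto
  moreover have "?f = (\<lambda>(r::int, l::int). exp (- a * ((of_int r)\<^sup>2 + (of_int l)\<^sup>2) + b * (\<bar>of_int r\<bar> + \<bar>of_int l\<bar>)))"
    by (auto simp: fun_eq_iff exp_add[symmetric] algebra_simps)
  ultimately show ?thesis by simp
qed

lemma summable_on_boundedI:
  fixes f :: "'i \<Rightarrow> complex"
  assumes "M summable_on A" and "\<And>i. i \<in> A \<Longrightarrow> norm (f i) \<le> M i"
  shows "f summable_on A"
  by (rule abs_summable_summable[OF summable_on_comparison_test[OF assms(1)]]) (use assms(2) in auto)

text \<open>The Weierstrass theorem for unordered sums: locally uniform majorants make the net of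
  finite partial sums converge locally uniformly.\<close>

lemma holomorphic_on_infsum:
  fixes f :: "'i \<Rightarrow> complex \<Rightarrow> complex"
  assumes hol: "\<And>i. i \<in> I \<Longrightarrow> f i holomorphic_on U"
    and bound: "\<And>z. z \<in> U \<Longrightarrow> \<exists>r>0. \<exists>M. cball z r \<subseteq> U \<and> M summable_on I \<and>
                  (\<forall>w\<in>cball z r. \<forall>i\<in>I. norm (f i w) \<le> M i)"
  shows "(\<lambda>z. \<Sum>\<^sub>\<infinity>i\<in>I. f i z) holomorphic_on U"
proof -
  have "(\<lambda>z. \<Sum>\<^sub>\<infinity>i\<in>I. f i z) analytic_on U"
    unfolding analytic_on_def
  proof
    fix z assume "z \<in> U"
    then obtain r M where r: "r > 0" "cball z r \<subseteq> U" "M summable_on I"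
      "\<And>w i. w \<in> cball z r \<Longrightarrow> i \<in> I \<Longrightarrow> norm (f i w) \<le> M i"
      using bound by blast
    have ul: "uniform_limit (cball z r) (\<lambda>X y. \<Sum>i\<in>X. f i y) (\<lambda>y. \<Sum>\<^sub>\<infinity>i\<in>I. f i y) (finite_subsets_at_top I)"
      by (rule Weierstrass_m_test_general[OF r(4) r(3)])
    have ev: "\<forall>\<^sub>F X in finite_subsets_at_top I.
       continuous_on (cball z r) (\<lambda>y. \<Sum>i\<in>X. f i y) \<and> (\<lambda>y. \<Sum>i\<in>X. f i y) holomorphic_on ball z r"
    proof (rule eventually_finite_subsets_at_top_weakI)
      fix X assume X: "finite X" "X \<subseteq> I"
      have "(\<lambda>y. \<Sum>i\<in>X. f i y) holomorphic_on cball z r"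
        by (rule holomorphic_on_subset[OF _ r(2)]) (use X in \<open>auto intro!: holomorphic_on_sum hol\<close>)
      then show "continuous_on (cball z r) (\<lambda>y. \<Sum>i\<in>X. f i y) \<and> (\<lambda>y. \<Sum>i\<in>X. f i y) holomorphic_on ball z r"
        by (meson holomorphic_on_imp_continuous_on holomorphic_on_subset ball_subset_cball)
    qed
    have "(\<lambda>z. \<Sum>\<^sub>\<infinity>i\<in>I. f i z) holomorphic_on ball z r"
      using holomorphic_uniform_limit[OF ev ul finite_subsets_at_top_neq_bot] by blast
    with r show "\<exists>e>0. (\<lambda>z. \<Sum>\<^sub>\<infinity>i\<in>I. f i z) holomorphic_on ball z e" by blast
  qed
  then show ?thesis by (rule analytic_imp_holomorphic)
qed

lemma infsum_finite_sum:
  fixes f :: "'i \<Rightarrow> 'a \<Rightarrow> complex"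
  assumes "finite I" and "\<And>i. i \<in> I \<Longrightarrow> f i summable_on S"
  shows "(\<lambda>x. \<Sum>i\<in>I. f i x) summable_on S"
    and "(\<Sum>\<^sub>\<infinity>x\<in>S. \<Sum>i\<in>I. f i x) = (\<Sum>i\<in>I. infsum (f i) S)"
proof -
  have "((\<lambda>x. \<Sum>i\<in>I. f i x) has_sum (\<Sum>i\<in>I. infsum (f i) S)) S"
    using assms by (induction I rule: finite_induct) (auto intro!: has_sum_add)
  then show "(\<lambda>x. \<Sum>i\<in>I. f i x) summable_on S"
    and "(\<Sum>\<^sub>\<infinity>x\<in>S. \<Sum>i\<in>I. f i x) = (\<Sum>i\<in>I. infsum (f i) S)"
    by (auto simp: has_sum_iff)
qed

lemma infsum_strip:
  fixes f :: "int \<times> int \<Rightarrow> complex"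
  assumes "f summable_on UNIV" "finite R" "\<And>r l. r \<notin> R \<Longrightarrow> f (r, l) = 0"
  shows "infsum f UNIV = (\<Sum>r\<in>R. \<Sum>\<^sub>\<infinity>l. f (r, l))"
proof -
  have "infsum f (UNIV \<times> UNIV) = (\<Sum>\<^sub>\<infinity>r. \<Sum>\<^sub>\<infinity>l. f (r, l))"
    by (rule infsum_Sigma_banach[symmetric]) (use assms in simp)
  also have "\<dots> = (\<Sum>\<^sub>\<infinity>r\<in>R. \<Sum>\<^sub>\<infinity>l. f (r, l))"
    by (rule infsum_cong_neutral) (auto simp: assms(3))
  finally show ?thesis using assms(2) by simp
qed

text \<open>On the disc the modulus of \<open>w\<close> varies by a factor of at most two around that of the centre, so one
  exponential in \<open>\<bar>n\<bar>\<close> majorises \<open>w powi n\<close> for both signs of \<open>n\<close>; a Gaussian factor absorbs it. This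
  is the source of all locally uniform majorants below.\<close>

lemma norm_powi_le_exp:
  fixes w z :: complex
  assumes "z \<noteq> 0" and "w \<in> cball z (norm z / 2)"
  shows "w \<noteq> 0" and "norm (w powi n) \<le> exp (\<bar>of_int n\<bar> * (\<bar>ln (norm z)\<bar> + ln 2))"
proof -
  have 1: "norm z / 2 \<le> norm w" "norm w \<le> 2 * norm z"
    using assms norm_triangle_ineq2[of z w] norm_triangle_ineq2[of w z]
    by (auto simp: dist_norm norm_minus_commute)
  then show w: "w \<noteq> 0" using assms by auto
  have "ln (norm z / 2) \<le> ln (norm w)" "ln (norm w) \<le> ln (2 * norm z)"
    using 1 w assms by auto
  then have ln: "\<bar>ln (norm w)\<bar> \<le> \<bar>ln (norm z)\<bar> + ln 2"
    using assms by (simp add: ln_div ln_mult)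
  have "norm (w powi n) = exp (of_int n * ln (norm w))"
    using w by (simp add: norm_power_int exp_power_int[symmetric])
  also have "of_int n * ln (norm w) \<le> \<bar>of_int n\<bar> * (\<bar>ln (norm z)\<bar> + ln 2)"
    by (rule order_trans[OF abs_ge_self]) (simp add: abs_mult mult_left_mono ln)
  finally show "norm (w powi n) \<le> exp (\<bar>of_int n\<bar> * (\<bar>ln (norm z)\<bar> + ln 2))" by simp
qed

section \<open>Functions on the punctured plane that are controlled under scaling\<close>

text \<open>Every point of the punctured unit disc is reached from the compact annulus
  \<open>|q|\<^sup>2 \<le> |x| \<le> 1\<close> by multiplications with \<open>q\<close>, and none of these steps exceeds the bound already
  attained. The maximum with \<open>D\<close> makes the lemma cover both exact invariance under \<open>x \<mapsto> q x\<close>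
  and contraction towards \<open>D\<close>.\<close>

lemma bounded_near_0_scaling:
  fixes H :: "complex \<Rightarrow> complex"
  assumes cont: "continuous_on (- {0}) H" and q: "0 < norm q" "norm q < 1"
    and scal: "\<And>x. x \<noteq> 0 \<Longrightarrow> norm x \<le> norm q \<Longrightarrow> norm (H (q * x)) \<le> max D (norm (H x))"
  shows "\<exists>B. \<forall>x. x \<noteq> 0 \<longrightarrow> norm x \<le> 1 \<longrightarrow> norm (H x) \<le> B"
proof -
  let ?K = "cball 0 1 - ball 0 ((norm q)\<^sup>2) :: complex set"
  have "compact ?K" by (intro compact_diff) auto
  moreover have "continuous_on ?K H"
    by (rule continuous_on_subset[OF cont]) (use q in auto)
  ultimately have "bounded (H ` ?K)"
    by (intro compact_imp_bounded compact_continuous_image)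
  then obtain M where M: "\<And>x. x \<in> ?K \<Longrightarrow> norm (H x) \<le> M"
    unfolding bounded_iff by blast
  define B where "B = max D M"
  have main: "norm (H x) \<le> B" if "norm q ^ n \<le> norm x" "norm x \<le> 1" for n x
    using that
  proof (induction n arbitrary: x)
    case 0
    moreover have "(norm q)\<^sup>2 \<le> 1" using q by (simp add: power_le_one)
    ultimately have "x \<in> ?K" by simp
    then show ?case using M unfolding B_def by fastforce
  next
    case (Suc n)
    show ?case
    proof (cases "x \<in> ?K")
      case True then show ?thesis using M unfolding B_def by fastforce
    next
      case False
      then have small: "norm x < (norm q)\<^sup>2" using Suc.prems by auto
      define y where "y = x / q"
      have x: "x = q * y" using q by (auto simp: y_def)
      have y: "norm q ^ n \<le> norm y" "norm y \<le> norm q" "y \<noteq> 0"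
      proof -
        have "norm q * norm q ^ n \<le> norm q * norm y" "norm q * norm y < norm q * norm q"
          using Suc.prems small unfolding x norm_mult power2_eq_square by simp_all
        then show "norm q ^ n \<le> norm y" "norm y \<le> norm q"
          using q mult_le_cancel_left_pos[of "norm q"] mult_less_cancel_left_pos[of "norm q"]
          by (simp_all add: less_imp_le)
        moreover have "0 < norm q ^ n" using q by (intro zero_less_power) simp
        ultimately show "y \<noteq> 0" by auto
      qed
      have "norm (H y) \<le> B" using Suc.IH y q by simp
      moreover have "norm (H x) \<le> max D (norm (H y))" unfolding x using scal y by auto
      ultimately show ?thesis unfolding B_def by linarith
    qed
  qed
  show ?thesis
  proof (intro exI allI impI)
    fix x :: complex assume x: "x \<noteq> 0" "norm x \<le> 1"
    obtain n where "norm q ^ n < norm x"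
      using real_arch_pow_inv[of "norm x" "norm q"] x q by auto
    then show "norm (H x) \<le> B" using main[of n x] x by simp
  qed
qed

text \<open>The behaviour at infinity is that of \<open>x \<mapsto> H (1 / x)\<close> at zero.\<close>

lemma bounded_punctured_plane_scaling:
  fixes H :: "complex \<Rightarrow> complex"
  assumes cont: "continuous_on (- {0}) H" and q: "0 < norm q" "norm q < 1"
    and inner: "\<And>x. x \<noteq> 0 \<Longrightarrow> norm x \<le> norm q \<Longrightarrow> norm (H (q * x)) \<le> max D (norm (H x))"
    and outer: "\<And>x. x \<noteq> 0 \<Longrightarrow> norm (q * x) \<ge> 1 / norm q \<Longrightarrow> norm (H x) \<le> max D (norm (H (q * x)))"
  shows "\<exists>B. \<forall>x. x \<noteq> 0 \<longrightarrow> norm (H x) \<le> B"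
proof -
  obtain B1 where B1: "\<forall>x. x \<noteq> 0 \<longrightarrow> norm x \<le> 1 \<longrightarrow> norm (H x) \<le> B1"
    using bounded_near_0_scaling[OF cont q inner] ..
  have cont': "continuous_on (- {0}) (\<lambda>x. H (inverse x))"
    by (rule continuous_on_compose2[OF cont]) (auto intro!: continuous_intros)
  have inner': "norm (H (inverse (q * x))) \<le> max D (norm (H (inverse x)))"
    if "x \<noteq> 0" "norm x \<le> norm q" for x
  proof -
    have "q * inverse (q * x) = inverse x" using q that by (simp add: field_simps)
    moreover have "1 / norm q \<le> norm (inverse x)"
      using that by (simp add: norm_inverse divide_inverse le_imp_inverse_le)
    moreover have "inverse (q * x) \<noteq> 0" using q that by simp
    ultimately show ?thesis using outer[of "inverse (q * x)"] by metis
  qed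
  obtain B2 where B2: "\<forall>x. x \<noteq> 0 \<longrightarrow> norm x \<le> 1 \<longrightarrow> norm (H (inverse x)) \<le> B2"
    using bounded_near_0_scaling[OF cont' q inner'] ..
  have "norm (H x) \<le> max B1 B2" if "x \<noteq> 0" for x
  proof (cases "norm x \<le> 1")
    case True then show ?thesis using B1 that by auto
  next
    case False
    then have "norm (inverse x) \<le> 1" by (simp add: norm_inverse inverse_le_1_iff)
    then show ?thesis using B2[rule_format, of "inverse x"] that by simp
  qed
  then show ?thesis by blast
qed

text \<open>Composition with \<open>exp\<close> gives a bounded entire function, and \<open>exp\<close> maps onto the
  punctured plane.\<close>

lemma bounded_holomorphic_punctured_plane_constant:
  fixes H :: "complex \<Rightarrow> complex"
  assumes hol: "H holomorphic_on - {0}" and bd: "\<And>x. x \<noteq> 0 \<Longrightarrow> norm (H x) \<le> B"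
  obtains c where "\<And>x. x \<noteq> 0 \<Longrightarrow> H x = c"
proof -
  have 1: "(H \<circ> exp) holomorphic_on UNIV"
    by (rule holomorphic_on_compose_gen[OF _ hol]) (auto intro!: holomorphic_intros)
  have 2: "bounded (range (H \<circ> exp))"
    unfolding bounded_iff using bd by (auto intro!: exI[of _ B])
  obtain c where c: "\<And>z. (H \<circ> exp) z = c"
    using Liouville_theorem[OF 1 2] unfolding constant_on_def by blast
  have "H x = c" if "x \<noteq> 0" for x using c[of "Ln x"] that by simp
  then show ?thesis using that by blast
qed

lemma q_periodic_bounded:
  fixes H :: "complex \<Rightarrow> complex"
  assumes "H holomorphic_on - {0}" "0 < norm q" "norm q < 1"
    and "\<And>x. x \<noteq> 0 \<Longrightarrow> H (q * x) = H x"
  obtains C where "\<And>x. x \<noteq> 0 \<Longrightarrow> norm (H x) \<le> C"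
  using bounded_punctured_plane_scaling[OF holomorphic_on_imp_continuous_on[OF assms(1)] assms(2,3), of 0]
    assms(4) by auto

lemma power_le_ends:
  fixes y :: real
  assumes "0 \<le> y" "1 \<le> k" "k \<le> N"
  shows "y ^ k \<le> y + y ^ N"
proof (cases "y \<le> 1")
  case True
  then have "y ^ k \<le> y ^ 1" using assms by (intro power_decreasing) auto
  then show ?thesis using assms by (simp add: add_increasing2)
next
  case False
  then have "y ^ k \<le> y ^ N" using assms by (intro power_increasing) auto
  then show ?thesis using assms by simp
qed

text \<open>For small \<open>x\<close> the inequality reads \<open>|H (q x)| \<le> 2 C + |q| |H x|\<close>, and for large \<open>x\<close> division by
  \<open>x\<^sup>N\<close> gives the same estimate in the opposite direction; \<open>D = 2 C / (1 - |q|)\<close> is the fixed point of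
  this contraction. So \<open>H\<close> is bounded, hence constant. The error term tolerates all powers
  \<open>x, \<dots>, x\<^sup>N\<close>, because the constant is read off at \<open>x \<rightarrow> 0\<close>, where each of them vanishes.\<close>

lemma q_difference_unique:
  fixes H :: "complex \<Rightarrow> complex" and N :: nat
  assumes hol: "H holomorphic_on - {0}" and q: "0 < norm q" "norm q < 1" and N: "N \<ge> 1"
    and eq: "\<And>x. x \<noteq> 0 \<Longrightarrow> norm (H (q * x) + x ^ N * H x) \<le> C * (norm x + norm x ^ N)"
    and x: "x \<noteq> 0"
  shows "H x = 0"
proof -
  have C: "C \<ge> 0"
  proof -
    have "0 \<le> C * (norm (1::complex) + norm (1::complex) ^ N)"
      by (rule order_trans[OF norm_ge_zero eq[of 1]]) simp
    then show ?thesis by simp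
  qed
  define D where "D = 2 * C / (1 - norm q)"
  have D: "2 * C + norm q * h \<le> max D h" if "h \<ge> 0" for h
  proof (cases "h \<ge> D")
    case True
    then have "2 * C \<le> h * (1 - norm q)" unfolding D_def using q by (simp add: field_simps)
    then show ?thesis by (simp add: algebra_simps)
  next
    case False
    have "2 * C + norm q * h \<le> 2 * C + norm q * D" using False q by (intro add_left_mono mult_left_mono) auto
    also have "\<dots> = D" unfolding D_def using q by (simp add: field_simps)
    finally show ?thesis by simp
  qed
  have inner: "norm (H (q * x)) \<le> max D (norm (H x))" if "x \<noteq> 0" "norm x \<le> norm q" for x
  proof -
    have "norm x ^ N \<le> norm x ^ 1" using N that q by (intro power_decreasing) auto
    then have xN: "norm x ^ N \<le> norm q" using that by simp
    have "norm (H (q * x)) \<le> norm (H (q * x) + x ^ N * H x) + norm (x ^ N * H x)"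
      using norm_triangle_ineq4[of "H (q * x) + x ^ N * H x" "x ^ N * H x"] by simp
    also have "\<dots> \<le> C * (1 + 1) + norm q * norm (H x)"
      unfolding norm_mult norm_power
    proof (intro add_mono mult_right_mono xN order_trans[OF eq])
      show "C * (norm x + norm x ^ N) \<le> C * (1 + 1)"
        using C q that xN by (intro mult_left_mono add_mono) auto
    qed (use that in auto)
    also have "\<dots> \<le> max D (norm (H x))" using D[of "norm (H x)"] by simp
    finally show ?thesis .
  qed
  have outer: "norm (H x) \<le> max D (norm (H (q * x)))" if "x \<noteq> 0" "norm (q * x) \<ge> 1 / norm q" for x
  proof -
    have "1 / norm q \<le> norm q * norm x" using that by (simp add: norm_mult)
    also have "\<dots> \<le> norm x" using q by (simp add: mult_left_le_one_le)
    finally have big: "1 / norm q \<le> norm x" .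
    then have x1: "1 \<le> norm x" using q by (smt (verit) le_divide_eq_1_pos)
    then have "norm x ^ 1 \<le> norm x ^ N" using N by (intro power_increasing) auto
    then have xN: "norm x \<le> norm x ^ N" "1 / norm q \<le> norm x ^ N" "0 < norm x ^ N" using big x1 by auto
    have "norm x ^ N * norm (H x) \<le> norm (H (q * x) + x ^ N * H x) + norm (H (q * x))"
      using norm_triangle_ineq4[of "H (q * x) + x ^ N * H x" "H (q * x)"] by (simp add: norm_mult norm_power)
    also have "\<dots> \<le> C * (norm x + norm x ^ N) + norm (H (q * x))" using eq that by simp
    also have "\<dots> \<le> C * (norm x ^ N + norm x ^ N) + (norm x ^ N * norm q) * norm (H (q * x))"
    proof (intro add_mono mult_left_mono C xN)
      have "1 \<le> norm x ^ N * norm q" using xN(2) q by (simp add: field_simps)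
      then show "norm (H (q * x)) \<le> (norm x ^ N * norm q) * norm (H (q * x))"
        by (simp add: mult_le_cancel_right1)
    qed auto
    also have "\<dots> = norm x ^ N * (2 * C + norm q * norm (H (q * x)))" by (simp add: algebra_simps)
    finally have "norm (H x) \<le> 2 * C + norm q * norm (H (q * x))" using xN(3) by simp
    also have "\<dots> \<le> max D (norm (H (q * x)))" by (rule D) simp
    finally show ?thesis .
  qed
  obtain B where "\<forall>x. x \<noteq> 0 \<longrightarrow> norm (H x) \<le> B"
    using bounded_punctured_plane_scaling[OF holomorphic_on_imp_continuous_on[OF hol] q inner outer] ..
  then obtain c where c: "\<And>x. x \<noteq> 0 \<Longrightarrow> H x = c"
    using bounded_holomorphic_punctured_plane_constant[OF hol, of B] by metis
  have "((\<lambda>z. norm (c + z ^ N * c)) \<longlongrightarrow> norm (c + 0 ^ N * c)) (at 0)"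
    by (intro tendsto_intros)
  moreover have "((\<lambda>z::complex. C * (norm z + norm z ^ N)) \<longlongrightarrow> C * (norm (0::complex) + norm (0::complex) ^ N)) (at 0)"
    by (intro tendsto_intros)
  moreover have "\<forall>\<^sub>F z in at 0. norm (c + z ^ N * c) \<le> C * (norm z + norm z ^ N)"
    using eq c q by (auto simp: eventually_at_filter)
  ultimately have "norm (c + 0 ^ N * c) \<le> C * (norm (0::complex) + norm (0::complex) ^ N)"
    by (intro tendsto_le[OF at_neq_bot])
  then have "c = 0" using N by (simp add: power_0_left)
  then show ?thesis using c x by simp
qed

section \<open>The Jacobi triple product\<close>

definition qfact :: "complex \<Rightarrow> nat \<Rightarrow> complex" where
  "qfact q n = (\<Prod>i<n. 1 - q * q ^ i)"

definition qbinomial :: "complex \<Rightarrow> nat \<Rightarrow> nat \<Rightarrow> complex" where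
  "qbinomial q N k = (if k \<le> N then qfact q N / (qfact q k * qfact q (N - k)) else 0)"

lemma qfact_0 [simp]: "qfact q 0 = 1"
  and qfact_Suc: "qfact q (Suc n) = (1 - q ^ Suc n) * qfact q n"
  by (simp_all add: qfact_def)

lemma one_minus_power_nonzero:
  fixes q :: complex
  assumes "norm q < 1"
  shows "1 - q ^ Suc n \<noteq> 0"
proof
  assume "1 - q ^ Suc n = 0"
  then have "norm (q ^ Suc n) = 1" by simp
  moreover have "norm q ^ Suc n \<le> norm q" using assms by (intro power_Suc_le_self) auto
  ultimately show False using assms by (simp add: norm_power norm_mult)
qed

lemma qfact_nonzero: "norm q < 1 \<Longrightarrow> qfact q n \<noteq> 0"
  by (induction n) (use one_minus_power_nonzero in \<open>auto simp: qfact_Suc simp del: power_Suc\<close>)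

text \<open>With \<open>u = 1 - q\<^bsup>k+1\<^esup>\<close> and \<open>v = 1 - q\<^bsup>N-k\<^esup>\<close> the identity clears denominators to
  \<open>1 - (1 - u) (1 - v) = v + (1 - v) u\<close>.\<close>

lemma qbinomial_Pascal:
  assumes "norm q < 1" "k \<le> N"
  shows "qbinomial q (Suc N) (Suc k) = qbinomial q N (Suc k) + q ^ (N - k) * qbinomial q N k"
proof (cases "k = N")
  case True
  then show ?thesis using qfact_nonzero[OF assms(1)] by (simp add: qbinomial_def)
next
  case False
  then obtain d where d: "N = Suc (k + d)"
    using assms(2) by (metis le_neq_implies_less less_iff_Suc_add)
  have nz: "qfact q k \<noteq> 0" "qfact q d \<noteq> 0" "1 - q ^ Suc k \<noteq> 0" "1 - q ^ Suc d \<noteq> 0"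
    using assms(1) qfact_nonzero one_minus_power_nonzero by blast+
  have e: "qfact q (Suc (Suc (k + d))) = (1 - q ^ Suc k * q ^ Suc d) * qfact q (Suc (k + d))"
    by (simp add: qfact_Suc power_add)
  define A where "A = qfact q (Suc (k + d))"
  define u where "u = 1 - q ^ Suc k"
  define v where "v = 1 - q ^ Suc d"
  have "(1 - (1 - u) * (1 - v)) * A / (u * qfact q k * (v * qfact q d)) =
        A / (u * qfact q k * qfact q d) + (1 - v) * (A / (qfact q k * (v * qfact q d)))"
    using nz unfolding u_def[symmetric] v_def[symmetric] by (simp add: field_simps)
  moreover have "qfact q (Suc k) = u * qfact q k" "qfact q (Suc d) = v * qfact q d"
    "q ^ Suc d = 1 - v" "q ^ Suc k = 1 - u"
    by (simp_all add: qfact_Suc u_def v_def)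
  moreover have "Suc N - Suc k = Suc d" "N - Suc k = d" "N - k = Suc d" using d by simp_all
  ultimately show ?thesis
    using e d unfolding qbinomial_def A_def by simp
qed

theorem q_binomial_theorem:
  assumes "norm q < 1"
  shows "(\<Prod>i<N. 1 + y * q ^ i) = (\<Sum>k\<le>N. q ^ (k choose 2) * qbinomial q N k * y ^ k)"
proof (induction N)
  case 0
  then show ?case by (simp add: qbinomial_def numeral_2_eq_2)
next
  case (Suc N)
  have b0: "qbinomial q M 0 = 1" for M
    using qfact_nonzero[OF assms] by (simp add: qbinomial_def)
  have choose: "Suc k choose 2 = (k choose 2) + k" for k
    by (simp add: numeral_2_eq_2)
  have "(\<Sum>k\<le>Suc N. q ^ (k choose 2) * qbinomial q (Suc N) k * y ^ k) =
        1 + (\<Sum>k\<le>N. q ^ (Suc k choose 2) * qbinomial q (Suc N) (Suc k) * y ^ Suc k)"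
    by (subst sum.atMost_Suc_shift) (simp add: b0 numeral_2_eq_2)
  also have "\<dots> = 1 + (\<Sum>k\<le>N. q ^ (Suc k choose 2) * qbinomial q N (Suc k) * y ^ Suc k
                     + y * q ^ N * (q ^ (k choose 2) * qbinomial q N k * y ^ k))"
  proof (intro arg_cong2[of _ _ _ _ "(+)"] sum.cong refl)
    fix k assume "k \<in> {..N}"
    then have k: "k \<le> N" and e: "q ^ N = q ^ k * q ^ (N - k)"
      by (auto simp: power_add[symmetric])
    show "q ^ (Suc k choose 2) * qbinomial q (Suc N) (Suc k) * y ^ Suc k =
        q ^ (Suc k choose 2) * qbinomial q N (Suc k) * y ^ Suc k
        + y * q ^ N * (q ^ (k choose 2) * qbinomial q N k * y ^ k)"
      unfolding qbinomial_Pascal[OF assms k] choose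
      by (simp add: e algebra_simps power_add)
  qed
  also have "\<dots> = (1 + (\<Sum>k\<le>N. q ^ (Suc k choose 2) * qbinomial q N (Suc k) * y ^ Suc k))
                   + y * q ^ N * (\<Sum>k\<le>N. q ^ (k choose 2) * qbinomial q N k * y ^ k)"
    by (simp add: sum.distrib sum_distrib_left)
  also have "1 + (\<Sum>k\<le>N. q ^ (Suc k choose 2) * qbinomial q N (Suc k) * y ^ Suc k)
             = (\<Sum>k\<le>Suc N. q ^ (k choose 2) * qbinomial q N k * y ^ k)"
    by (subst sum.atMost_Suc_shift) (simp add: b0 numeral_2_eq_2)
  also have "\<dots> = (\<Sum>k\<le>N. q ^ (k choose 2) * qbinomial q N k * y ^ k)"
    by (simp add: qbinomial_def)
  finally show ?case
    unfolding Suc.IH[symmetric] prod.lessThan_Suc by (simp only: ring_distribs mult_1_left mult_1_right mult_ac)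
qed

lemma qpoch_LIMSEQ:
  assumes "norm q < 1"
  shows "(\<lambda>n. \<Prod>i<n. 1 - a * q ^ i) \<longlonglongrightarrow> qpoch a q"
proof -
  have "summable (\<lambda>i. norm (a * q ^ i))"
    using assms by (simp add: norm_mult norm_power summable_mult summable_geometric)
  then have "abs_convergent_prod (\<lambda>i. 1 - a * q ^ i)"
    by (intro summable_imp_abs_convergent_prod) simp
  then have "convergent_prod (\<lambda>i. 1 - a * q ^ i)"
    by (rule abs_convergent_prod_imp_convergent_prod)
  then show ?thesis
    unfolding qpoch_def using convergent_prod_LIMSEQ LIMSEQ_lessThan_iff_atMost by blast
qed

lemma qpoch_self_nonzero:
  assumes "norm q < 1"
  shows "qpoch q q \<noteq> 0"
proof -
  have "summable (\<lambda>i. norm (q * q ^ i))"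
    using assms by (simp add: norm_mult norm_power summable_mult summable_geometric)
  then have "abs_convergent_prod (\<lambda>i. 1 - q * q ^ i)"
    by (intro summable_imp_abs_convergent_prod) simp
  then have "convergent_prod (\<lambda>i. 1 - q * q ^ i)"
    by (rule abs_convergent_prod_imp_convergent_prod)
  then show ?thesis
    unfolding qpoch_def using one_minus_power_nonzero[OF assms]
    by (intro prodinf_nonzero) simp_all
qed

lemma qfact_LIMSEQ: "norm q < 1 \<Longrightarrow> qfact q \<longlonglongrightarrow> qpoch q q"
  using qpoch_LIMSEQ[of q q] by (simp add: qfact_def[abs_def])

lemma qbinomial_bounded:
  assumes "norm q < 1"
  obtains B where "\<And>N k. norm (qbinomial q N k) \<le> B"
proof -
  have "Bseq (qfact q)"
    using qfact_LIMSEQ[OF assms] by (intro convergent_imp_Bseq convergentI)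
  then obtain B1 where B1: "\<And>n. norm (qfact q n) \<le> B1" unfolding Bseq_def by blast
  have "Bseq (\<lambda>n. inverse (qfact q n))"
    using tendsto_inverse[OF qfact_LIMSEQ[OF assms] qpoch_self_nonzero[OF assms]]
    by (intro convergent_imp_Bseq convergentI)
  then obtain B2 where B2: "\<And>n. norm (inverse (qfact q n)) \<le> B2" unfolding Bseq_def by blast
  have nn: "0 \<le> B1" "0 \<le> B2" using B1[of 0] B2[of 0] norm_ge_zero by (auto intro: order_trans)
  have "norm (qbinomial q N k) \<le> B1 * (B2 * B2)" for N k
  proof (cases "k \<le> N")
    case True
    have "norm (qfact q N * (inverse (qfact q k) * inverse (qfact q (N - k)))) \<le> B1 * (B2 * B2)"
      unfolding norm_mult by (intro mult_mono B1 B2 nn mult_nonneg_nonneg norm_ge_zero)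
    then show ?thesis using True by (simp add: qbinomial_def divide_inverse)
  qed (use nn in \<open>simp add: qbinomial_def\<close>)
  then show ?thesis using that by blast
qed

text \<open>Tannery's theorem, carried over from series over the naturals by the bijection \<open>int_decode\<close>.\<close>

lemma tendsto_infsum_int_dominated:
  fixes f :: "nat \<Rightarrow> int \<Rightarrow> complex"
  assumes lim: "\<And>j. (\<lambda>n. f n j) \<longlonglongrightarrow> g j"
    and bound: "\<And>n j. norm (f n j) \<le> M j" and M: "M summable_on UNIV"
  shows "(\<lambda>n. \<Sum>\<^sub>\<infinity>j. f n j) \<longlonglongrightarrow> (\<Sum>\<^sub>\<infinity>j. g j)"
proof -
  have bij: "bij_betw int_decode UNIV UNIV" by (rule bij_int_decode)
  have sumM: "summable (\<lambda>k. M (int_decode k))"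
    using M summable_on_reindex_bij_betw[OF bij, of M] by (intro summable_on_imp_summable) simp
  have eq: "infsum h UNIV = (\<Sum>k. h (int_decode k))" if "\<And>j. norm (h j) \<le> M j" for h :: "int \<Rightarrow> complex"
  proof -
    have "h summable_on UNIV" by (rule summable_on_boundedI[OF M]) (use that in auto)
    then have "((\<lambda>k. h (int_decode k)) has_sum infsum h UNIV) UNIV"
      using has_sum_reindex_bij_betw[OF bij, of h "infsum h UNIV"] by simp
    then show ?thesis using has_sum_imp_sums sums_unique by blast
  qed
  have gb: "norm (g j) \<le> M j" for j
    by (rule LIMSEQ_le_const2[OF tendsto_norm[OF lim[of j]]]) (use bound in auto)
  have "(\<lambda>n. \<Sum>k. f n (int_decode k)) \<longlonglongrightarrow> (\<Sum>k. g (int_decode k))"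
    using tannerys_theorem[of "\<lambda>k n. f n (int_decode k)" "\<lambda>k. g (int_decode k)" sequentially
        "\<lambda>k. M (int_decode k)"] lim bound sumM by (simp add: always_eventually)
  then show ?thesis using eq[OF bound] eq[OF gb] by simp
qed

lemma qpow_add: "qpow \<tau> (a + b) = qpow \<tau> a * qpow \<tau> b"
  by (simp add: qpow_def exp_add[symmetric] algebra_simps)

lemma qpow_0 [simp]: "qpow \<tau> 0 = 1" and qpow_nonzero [simp]: "qpow \<tau> a \<noteq> 0"
  by (simp_all add: qpow_def)

lemma qpow_minus: "qpow \<tau> (- a) = inverse (qpow \<tau> a)"
  by (simp add: qpow_def exp_minus[symmetric])

lemma qpow_power: "qpow \<tau> a ^ n = qpow \<tau> (of_nat n * a)"
  by (simp add: qpow_def exp_of_nat_mult[symmetric] algebra_simps)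

lemma qpow_powi: "qpow \<tau> a powi n = qpow \<tau> (of_int n * a)"
proof (cases "n \<ge> 0")
  case True
  then show ?thesis by (simp add: power_int_def qpow_power)
next
  case False
  then show ?thesis by (simp add: power_int_def qpow_power power_inverse qpow_minus[symmetric])
qed

lemma norm_qpow: "norm (qpow \<tau> a) = exp (- (2 * pi * Im \<tau>) * a)"
  by (simp add: qpow_def norm_exp_eq_Re algebra_simps)

text \<open>The powers of \<open>q\<close> are written \<open>Q \<alpha>\<close>, so that products of them reduce to identities between real
  exponents; \<open>rate = - ln |q|\<close>.\<close>

locale nome =
  fixes \<tau> :: complex
  assumes Im_pos: "Im \<tau> > 0"
begin

abbreviation Q :: "real \<Rightarrow> complex" where "Q \<equiv> qpow \<tau>"

abbreviation rate :: real where "rate \<equiv> 2 * pi * Im \<tau>"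

lemma rate_pos: "rate > 0" using Im_pos by simp

lemma norm_Q1: "0 < norm (Q 1)" "norm (Q 1) < 1"
  using Im_pos by (simp_all add: norm_qpow)

text \<open>The summands \<open>(-1)\<^sup>n q\<^bsup>n(n-1)/2\<^esup> x\<^sup>n\<close> of the theta series.\<close>

definition jacobi_term :: "complex \<Rightarrow> int \<Rightarrow> complex" where
  "jacobi_term x n = Q (((of_int n)\<^sup>2 - of_int n) / 2) * (- x) powi n"

lemma jacobi_term_bound:
  assumes "z \<noteq> 0" "w \<in> cball z (norm z / 2)"
  shows "norm (jacobi_term w n) \<le>
    exp (- (rate / 2) * (of_int n)\<^sup>2 + (rate / 2 + (\<bar>ln (norm z)\<bar> + ln 2)) * \<bar>of_int n\<bar>)"
proof -
  have "norm ((- w) powi n) \<le> exp (\<bar>of_int n\<bar> * (\<bar>ln (norm z)\<bar> + ln 2))"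
    using norm_powi_le_exp(2)[OF assms, of n] by (simp add: norm_power_int)
  moreover have "norm (Q (((of_int n)\<^sup>2 - of_int n) / 2)) \<le> exp (- (rate / 2) * (of_int n)\<^sup>2 + (rate / 2) * \<bar>of_int n\<bar>)"
  proof -
    have "rate * of_int n \<le> rate * \<bar>of_int n\<bar>" using rate_pos by (intro mult_left_mono) auto
    then show ?thesis by (simp add: norm_qpow algebra_simps diff_divide_distrib)
  qed
  ultimately have "norm (jacobi_term w n) \<le> exp (- (rate / 2) * (of_int n)\<^sup>2 + (rate / 2) * \<bar>of_int n\<bar>) * exp (\<bar>of_int n\<bar> * (\<bar>ln (norm z)\<bar> + ln 2))"
    unfolding jacobi_term_def norm_mult by (intro mult_mono) auto
  then show ?thesis by (simp add: exp_add[symmetric] algebra_simps)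
qed

lemma jacobi_bound_summable:
  "(\<lambda>n::int. exp (- (rate / 2) * (of_int n)\<^sup>2 + b * \<bar>of_int n\<bar>)) summable_on UNIV"
  using rate_pos by (intro summable_on_gauss) simp

lemma jacobi_term_summable: "x \<noteq> 0 \<Longrightarrow> jacobi_term x summable_on UNIV"
  by (rule summable_on_boundedI[OF jacobi_bound_summable jacobi_term_bound]) auto

text \<open>The \<open>q\<close>-binomial theorem with \<open>2 n\<close> factors and \<open>y = - x q\<^bsup>-n\<^esup>\<close>: the first \<open>n\<close> factors
  \<open>1 - x q\<^bsup>-i\<^esup>\<close> are turned round into \<open>- x q\<^bsup>-i\<^esup> (1 - q\<^sup>i / x)\<close>, and the summation index is centred
  at \<open>n\<close>.\<close>

lemma finite_Jacobi:
  assumes "x \<noteq> 0"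
  shows "(\<Prod>i<n. 1 - x * Q 1 ^ i) * (\<Prod>i<n. 1 - (Q 1 / x) * Q 1 ^ i) =
    (\<Sum>\<^sub>\<infinity>j. if \<bar>j\<bar> \<le> int n then jacobi_term x j * qbinomial (Q 1) (2 * n) (nat (int n + j)) else 0)"
proof -
  let ?q = "Q 1"
  define y where "y = - x * Q (- of_nat n)"
  have y0: "y \<noteq> 0" using assms by (simp add: y_def)
  have split: "(\<Prod>i<n + m. g i) = (\<Prod>i<n. g i) * (\<Prod>i<m. g (n + i))" for g :: "nat \<Rightarrow> complex" and m
    by (induction m) (simp_all add: mult.assoc)
  have "(\<Prod>i<n. 1 + y * ?q ^ i) = (\<Prod>i<n. (- x * Q (- of_nat (Suc i))) * (1 - (?q / x) * ?q ^ i))"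
  proof (subst prod.nat_diff_reindex[symmetric], intro prod.cong refl)
    fix i assume "i \<in> {..<n}"
    then have "real (n - Suc i) = real n - real (Suc i)" by (simp add: of_nat_diff)
    then have "y * ?q ^ (n - Suc i) = - x * Q (- of_nat (Suc i))"
      by (simp add: y_def qpow_power qpow_add[symmetric])
    moreover have "Q (- of_nat (Suc i)) * (?q * ?q ^ i) = 1"
      by (simp add: qpow_power qpow_add[symmetric])
    ultimately show "1 + y * ?q ^ (n - Suc i) = (- x * Q (- of_nat (Suc i))) * (1 - (?q / x) * ?q ^ i)"
      using assms by (simp add: field_simps)
  qed
  also have "\<dots> = (\<Prod>i<n. - x * Q (- of_nat (Suc i))) * (\<Prod>i<n. 1 - (?q / x) * ?q ^ i)"
    by (rule prod.distrib)
  also have "(\<Prod>i<n. - x * Q (- of_nat (Suc i))) = (- x) ^ n * Q (- (of_nat n * (of_nat n + 1) / 2))"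
  proof (induction n)
    case (Suc n)
    have "Q (- (of_nat (Suc n) * (of_nat (Suc n) + 1) / 2)) = Q (- (of_nat n * (of_nat n + 1) / 2)) * Q (- of_nat (Suc n))"
      unfolding qpow_add[symmetric] by (rule arg_cong[where f = Q]) (simp add: field_simps)
    then show ?case by (simp only: prod.lessThan_Suc Suc.IH) simp
  qed simp
  finally have A: "(\<Prod>i<n. 1 + y * ?q ^ i) =
    (- x) ^ n * Q (- (of_nat n * (of_nat n + 1) / 2)) * (\<Prod>i<n. 1 - (?q / x) * ?q ^ i)" .
  have B: "(\<Prod>i<n. 1 + y * ?q ^ (n + i)) = (\<Prod>i<n. 1 - x * ?q ^ i)"
  proof (intro prod.cong refl)
    fix i
    show "1 + y * ?q ^ (n + i) = 1 - x * ?q ^ i"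
      by (simp add: y_def qpow_power mult.assoc qpow_add[symmetric])
  qed
  define c where "c = (- x) ^ n * Q (- (of_nat n * (of_nat n + 1) / 2))"
  have c0: "c \<noteq> 0" using assms by (simp add: c_def)
  have "c * ((\<Prod>i<n. 1 - x * ?q ^ i) * (\<Prod>i<n. 1 - (?q / x) * ?q ^ i)) = (\<Prod>i<n + n. 1 + y * ?q ^ i)"
    unfolding split A B c_def by simp
  also have "\<dots> = (\<Sum>k\<le>2 * n. ?q ^ (k choose 2) * qbinomial ?q (2 * n) k * y ^ k)"
    by (simp add: q_binomial_theorem[OF norm_Q1(2)] mult_2)
  also have "\<dots> = (\<Sum>j\<in>{- int n..int n}. c * (jacobi_term x j * qbinomial ?q (2 * n) (nat (int n + j))))"
  proof (rule sum.reindex_bij_witness[of _ "\<lambda>j. nat (int n + j)" "\<lambda>k. int k - int n"])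
    fix k assume "k \<in> {..2 * n}"
    have "?q ^ (k choose 2) * y ^ k = c * jacobi_term x (int k - int n)"
    proof -
      have ch: "real (k choose 2) = (real k * (real k - 1)) / 2"
        by (induction k) (simp_all add: numeral_2_eq_2 field_simps)
      have "?q ^ (k choose 2) * y ^ k = (- x) ^ k * Q (real k * (real k - 1) / 2 - real n * real k)"
        by (simp add: y_def power_mult_distrib qpow_power ch qpow_add[symmetric] power_minus[of "x * _"] power_minus[of x] algebra_simps)
      moreover have "c * jacobi_term x (int k - int n) = ((- x) ^ n * (- x) powi (int k - int n)) *
         Q (- (of_nat n * (of_nat n + 1) / 2) + ((real k - real n)\<^sup>2 - (real k - real n)) / 2)"
        by (simp only: c_def jacobi_term_def qpow_add of_int_diff of_int_of_nat_eq mult_ac)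
      moreover have "(- x) ^ n * (- x) powi (int k - int n) = (- x) ^ k"
        using assms by (simp add: power_int_diff)
      moreover have "real k * (real k - 1) / 2 - real n * real k =
         - (of_nat n * (of_nat n + 1) / 2) + ((real k - real n)\<^sup>2 - (real k - real n)) / 2"
        by (simp add: power2_eq_square field_simps)
      ultimately show ?thesis by simp
    qed
    then show "c * (jacobi_term x (int k - int n) * qbinomial ?q (2 * n) (nat (int n + (int k - int n)))) =
       ?q ^ (k choose 2) * qbinomial ?q (2 * n) k * y ^ k"
      by (simp add: mult_ac)
  qed auto
  also have "\<dots> = c * (\<Sum>j\<in>{- int n..int n}. jacobi_term x j * qbinomial ?q (2 * n) (nat (int n + j)))"
    by (simp add: sum_distrib_left)
  also have "(\<Sum>j\<in>{- int n..int n}. jacobi_term x j * qbinomial ?q (2 * n) (nat (int n + j))) =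
    (\<Sum>\<^sub>\<infinity>j. if \<bar>j\<bar> \<le> int n then jacobi_term x j * qbinomial ?q (2 * n) (nat (int n + j)) else 0)"
    by (subst infsum_finite[symmetric], simp, rule infsum_cong_neutral) auto
  finally show ?thesis using c0 by simp
qed

text \<open>The limit \<open>n \<rightarrow> \<infinity>\<close> of the finite identity: the Gaussian binomials tend to \<open>1 / (q)\<^sub>\<infinity>\<close> and are
  uniformly bounded, so the theta series dominates.\<close>

theorem Jacobi_triple_product:
  assumes "x \<noteq> 0"
  shows "Theta x (Q 1) = (\<Sum>\<^sub>\<infinity>n. jacobi_term x n)"
proof -
  let ?q = "Q 1" and ?P = "qpoch (Q 1) (Q 1)"
  let ?f = "\<lambda>n j. if \<bar>j\<bar> \<le> int n then jacobi_term x j * qbinomial ?q (2 * n) (nat (int n + j)) else 0"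
  obtain B where B: "\<And>N k. norm (qbinomial ?q N k) \<le> B"
    using qbinomial_bounded[OF norm_Q1(2)] by blast
  have B0: "0 \<le> B" using B[of 0 0] norm_ge_zero order_trans by blast
  have P0: "?P \<noteq> 0" by (rule qpoch_self_nonzero[OF norm_Q1(2)])
  have "(\<lambda>n. \<Sum>\<^sub>\<infinity>j. ?f n j) \<longlonglongrightarrow> (\<Sum>\<^sub>\<infinity>j. jacobi_term x j * (1 / ?P))"
  proof (rule tendsto_infsum_int_dominated)
    fix j :: int
    have f1: "filterlim (\<lambda>n::nat. 2 * n) at_top sequentially"
      by (rule filterlim_subseq) (simp add: strict_mono_def)
    have f2: "filterlim (\<lambda>n::nat. nat (int n + j)) at_top sequentially" for j
      unfolding filterlim_at_top
    proof
      fix Z :: nat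
      show "\<forall>\<^sub>F n in sequentially. Z \<le> nat (int n + j)"
        by (rule eventually_sequentiallyI[of "nat (int Z - j)"]) auto
    qed
    have lim: "(\<lambda>n. qfact ?q (2 * n) / (qfact ?q (nat (int n + j)) * qfact ?q (nat (int n + - j)))) \<longlonglongrightarrow> ?P / (?P * ?P)"
      by (intro tendsto_intros filterlim_compose[OF qfact_LIMSEQ[OF norm_Q1(2)]] f1 f2) (use P0 in simp)
    have "(\<lambda>n. qfact ?q (2 * n) / (qfact ?q (nat (int n + j)) * qfact ?q (nat (int n + - j))) * jacobi_term x j)
      \<longlonglongrightarrow> ?P / (?P * ?P) * jacobi_term x j"
      by (intro tendsto_mult_right lim)
    moreover have "\<forall>\<^sub>F n in sequentially. qfact ?q (2 * n) / (qfact ?q (nat (int n + j)) * qfact ?q (nat (int n + - j))) * jacobi_term x j = ?f n j"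
    proof (rule eventually_sequentiallyI)
      fix n assume "nat \<bar>j\<bar> \<le> n"
      then have "\<bar>j\<bar> \<le> int n" "nat (int n + j) \<le> 2 * n" "2 * n - nat (int n + j) = nat (int n + - j)" by auto
      then show "qfact ?q (2 * n) / (qfact ?q (nat (int n + j)) * qfact ?q (nat (int n + - j))) * jacobi_term x j = ?f n j"
        by (simp add: qbinomial_def)
    qed
    ultimately have "(\<lambda>n. ?f n j) \<longlonglongrightarrow> ?P / (?P * ?P) * jacobi_term x j"
      by (rule Lim_transform_eventually)
    then show "(\<lambda>n. ?f n j) \<longlonglongrightarrow> jacobi_term x j * (1 / ?P)" using P0 by (simp add: mult.commute)
  next
    show "norm (?f n j) \<le> norm (jacobi_term x j) * B" for n j
      using B B0 by (auto simp: norm_mult intro!: mult_left_mono)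
    show "(\<lambda>j. norm (jacobi_term x j) * B) summable_on UNIV"
      using jacobi_term_summable[OF assms] by (intro summable_on_cmult_left) (simp add: summable_on_iff_abs_summable_on_complex)
  qed
  moreover have "(\<lambda>n. \<Sum>\<^sub>\<infinity>j. ?f n j) \<longlonglongrightarrow> qpoch x ?q * qpoch (?q / x) ?q"
    unfolding finite_Jacobi[OF assms, symmetric]
    by (intro tendsto_mult qpoch_LIMSEQ norm_Q1)
  ultimately have "qpoch x ?q * qpoch (?q / x) ?q = (\<Sum>\<^sub>\<infinity>j. jacobi_term x j * (1 / ?P))"
    using LIMSEQ_unique by blast
  also have "\<dots> = (\<Sum>\<^sub>\<infinity>j. jacobi_term x j) * (1 / ?P)" by (rule infsum_cmult_left')
  finally show ?thesis using P0 by (simp add: Theta_def)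
qed

section \<open>The theta function and sums of Appell type\<close>

lemma Theta_holomorphic: "(\<lambda>x. Theta x (Q 1)) holomorphic_on - {0}"
proof -
  have "(\<lambda>x. \<Sum>\<^sub>\<infinity>n\<in>UNIV. jacobi_term x n) holomorphic_on - {0}"
  proof (rule holomorphic_on_infsum)
    show "(\<lambda>x. jacobi_term x n) holomorphic_on - {0}" for n
      unfolding jacobi_term_def by (auto intro!: holomorphic_intros)
    fix z :: complex assume "z \<in> - {0}"
    then have z: "z \<noteq> 0" by simp
    define b where "b = rate / 2 + (\<bar>ln (norm z)\<bar> + ln 2)"
    show "\<exists>r>0. \<exists>M. cball z r \<subseteq> - {0} \<and> M summable_on UNIV \<and>
            (\<forall>w\<in>cball z r. \<forall>i\<in>UNIV. norm (jacobi_term w i) \<le> M i)"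
    proof (intro exI conjI ballI)
      show "norm z / 2 > 0" using z by simp
      show "cball z (norm z / 2) \<subseteq> - {0}" using norm_powi_le_exp(1)[OF z] by auto
      show "(\<lambda>n::int. exp (- (rate / 2) * (of_int n)\<^sup>2 + b * \<bar>of_int n\<bar>)) summable_on UNIV"
        by (rule jacobi_bound_summable)
      show "norm (jacobi_term w i) \<le> exp (- (rate / 2) * (of_int i)\<^sup>2 + b * \<bar>of_int i\<bar>)"
        if "w \<in> cball z (norm z / 2)" for w i
        unfolding b_def by (rule jacobi_term_bound[OF z that])
    qed
  qed
  then show ?thesis
    by (rule holomorphic_transform) (simp add: Jacobi_triple_product)
qed

lemma Theta_shift:
  assumes "x \<noteq> 0"
  shows "Theta (Q 1 * x) (Q 1) = - Theta x (Q 1) / x"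
proof -
  have "(\<Sum>\<^sub>\<infinity>n. jacobi_term (Q 1 * x) n) = (\<Sum>\<^sub>\<infinity>n. jacobi_term x n * (- 1 / x))"
  proof (rule infsum_reindex_bij_witness[of _ "\<lambda>n. n - 1" "\<lambda>n. n + 1"])
    fix n :: int
    have "((of_int (n + 1))\<^sup>2 - of_int (n + 1)) / 2 = ((of_int n)\<^sup>2 - of_int n) / 2 + (of_int n :: real)"
      by (simp add: power2_eq_square field_simps)
    then have "Q (((of_int (n + 1))\<^sup>2 - of_int (n + 1)) / 2) = Q (((of_int n)\<^sup>2 - of_int n) / 2) * Q (of_int n)"
      by (simp only: qpow_add)
    moreover have "(- (Q 1 * x)) powi n = Q 1 powi n * (- x) powi n"
      unfolding power_int_mult_distrib[symmetric] by simp
    then have "(- (Q 1 * x)) powi n = Q (of_int n) * (- x) powi n"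
      by (simp only: qpow_powi mult_1_right)
    moreover have "(- x) powi (n + 1) = (- x) powi n * (- x)"
      using assms by (simp add: power_int_add)
    ultimately show "jacobi_term x (n + 1) * (- 1 / x) = jacobi_term (Q 1 * x) n"
      using assms by (simp add: jacobi_term_def)
  qed auto
  also have "\<dots> = (\<Sum>\<^sub>\<infinity>n. jacobi_term x n) * (- 1 / x)" by (rule infsum_cmult_left')
  finally show ?thesis using assms by (simp add: Jacobi_triple_product)
qed

text \<open>The boundary terms of the cone of summation, \<open>(-1)\<^sup>n q\<^bsup>n(n+1)/2 + a n\<^esup>\<close>: they are
  the summands of the theta series at its zero \<open>x = q\<^bsup>a+1\<^esup>\<close>.\<close>

definition edge :: "int \<Rightarrow> int \<Rightarrow> complex" where
  "edge a n = (- 1) powi n * Q (((of_int n)\<^sup>2 + of_int n) / 2 + of_int a * of_int n)"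

text \<open>The reflection \<open>n \<mapsto> - 1 - 2 a - n\<close> fixes the exponent and reverses the sign.\<close>

lemma edge_vanish: "(\<Sum>\<^sub>\<infinity>n. edge a n) = 0"
proof -
  have "(\<Sum>\<^sub>\<infinity>n. edge a n) = (\<Sum>\<^sub>\<infinity>n. - edge a n)"
  proof (rule infsum_reindex_bij_witness[of _ "\<lambda>n. - 1 - 2 * a - n" "\<lambda>n. - 1 - 2 * a - n"])
    fix n :: int
    have "((of_int (- 1 - 2 * a - n))\<^sup>2 + of_int (- 1 - 2 * a - n)) / 2 + of_int a * of_int (- 1 - 2 * a - n)
      = ((of_int n)\<^sup>2 + of_int n) / 2 + of_int a * (of_int n :: real)"
      by (simp add: power2_eq_square field_simps)
    moreover have "(- 1 :: complex) powi (- 1 - 2 * a - n) = - ((- 1) powi n)"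
      by (simp add: power_int_minus_left)
    ultimately show "- edge a (- 1 - 2 * a - n) = edge a n" by (simp only: edge_def) simp
  qed auto
  also have "\<dots> = - (\<Sum>\<^sub>\<infinity>n. edge a n)" by (rule infsum_uminus)
  finally show ?thesis by simp
qed

lemma edge_summable: "edge a summable_on UNIV"
proof (rule summable_on_boundedI[OF jacobi_bound_summable[of "rate * (1 / 2 + \<bar>of_int a\<bar>)"]])
  fix n :: int
  have "\<bar>(1 / 2 + of_int a) * of_int n\<bar> \<le> (1 / 2 + \<bar>of_int a\<bar>) * \<bar>of_int n :: real\<bar>"
    unfolding abs_mult by (intro mult_right_mono) auto
  then have "- ((1 / 2 + of_int a) * of_int n) \<le> (1 / 2 + \<bar>of_int a\<bar>) * \<bar>of_int n :: real\<bar>" by simp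
  then have "rate * - ((1 / 2 + of_int a) * of_int n) \<le> rate * ((1 / 2 + \<bar>of_int a\<bar>) * \<bar>of_int n :: real\<bar>)"
    using rate_pos by (intro mult_left_mono) auto
  then have "- rate * (((of_int n)\<^sup>2 + of_int n) / 2 + of_int a * of_int n)
     \<le> - (rate / 2) * (of_int n)\<^sup>2 + rate * (1 / 2 + \<bar>of_int a\<bar>) * \<bar>of_int n\<bar>"
    by (simp add: algebra_simps add_divide_distrib)
  then show "norm (edge a n) \<le> exp (- (rate / 2) * (of_int n)\<^sup>2 + rate * (1 / 2 + \<bar>of_int a\<bar>) * \<bar>of_int n\<bar>)"
    by (simp add: edge_def norm_mult norm_power_int norm_qpow)
qed

text \<open>The points where \<open>\<Theta>\<close> vanishes and where a sum of Appell type has a pole.\<close>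

definition qlattice :: "complex set" where
  "qlattice = range (\<lambda>n::int. Q (of_int n))"

lemma not_qlattice_iff: "x \<notin> qlattice \<longleftrightarrow> (\<forall>n::int. x * Q (of_int n) \<noteq> 1)"
proof -
  have *: "x * Q (of_int n) = 1 \<longleftrightarrow> x = Q (of_int (- n))" for n
    by (simp add: qpow_minus field_simps)
  have "x \<in> qlattice \<longleftrightarrow> (\<exists>n::int. x = Q (of_int (- n)))"
    unfolding qlattice_def image_iff by (metis UNIV_I minus_minus)
  then show ?thesis unfolding * by blast
qed

lemma Theta_qlattice: "x \<in> qlattice \<Longrightarrow> Theta x (Q 1) = 0"
proof -
  assume "x \<in> qlattice"
  then obtain c :: int where x: "x = Q (of_int c)" unfolding qlattice_def by blast
  have "jacobi_term x n = edge (c - 1) n" for n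
  proof -
    have "(- x) powi n = (- 1) powi n * Q (of_int n * of_int c)"
      unfolding x qpow_powi[symmetric] power_int_mult_distrib[symmetric] by simp
    moreover have "((of_int n)\<^sup>2 - of_int n) / 2 + of_int n * of_int c = ((of_int n)\<^sup>2 + of_int n) / 2 + of_int (c - 1) * (of_int n :: real)"
      by (simp add: field_simps)
    ultimately show ?thesis by (simp add: jacobi_term_def edge_def qpow_add[symmetric])
  qed
  then show ?thesis using edge_vanish[of "c - 1"] by (simp add: Jacobi_triple_product x)
qed

lemma qlattice_shift: "Q 1 * x \<in> qlattice \<longleftrightarrow> x \<in> qlattice"
proof -
  have "(\<forall>n::int. Q 1 * x * Q (of_int n) \<noteq> 1) \<longleftrightarrow> (\<forall>n::int. x * Q (of_int n) \<noteq> 1)"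
  proof (intro iffI allI notI)
    fix n :: int assume "\<forall>n::int. Q 1 * x * Q (of_int n) \<noteq> 1" "x * Q (of_int n) = 1"
    moreover have "Q (of_int n) = Q 1 * Q (of_int (n - 1))" by (simp add: qpow_add[symmetric])
    ultimately show False by (metis mult.assoc mult.commute)
  next
    fix n :: int assume "\<forall>n::int. x * Q (of_int n) \<noteq> 1" "Q 1 * x * Q (of_int n) = 1"
    moreover have "Q (of_int (n + 1)) = Q 1 * Q (of_int n)" by (simp add: qpow_add[symmetric] add.commute)
    ultimately show False by (metis mult.assoc mult.commute)
  qed
  then show ?thesis using not_qlattice_iff by blast
qed

text \<open>For large \<open>\<bar>n\<bar>\<close> the product \<open>w q\<^sup>n\<close> is of modulus at most \<open>1 / 2\<close> or at least \<open>2\<close> on the whole disc;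
  the remaining finitely many \<open>n\<close> are handled by continuity. The excluded \<open>n\<close>, at most one, is the one
  that makes the centre \<open>z\<close> a pole.\<close>

lemma denominators_bounded_below:
  assumes z: "z \<noteq> 0"
  obtains r \<delta> where "r > 0" "\<delta> > 0" "cball z r \<subseteq> - {0}"
    "\<And>w n. w \<in> cball z r \<Longrightarrow> z * Q (of_int n) \<noteq> 1 \<Longrightarrow> \<delta> \<le> norm (1 - w * Q (of_int n))"
proof -
  \<comment> \<open>For \<open>n * rate > L\<close> the product is at most \<open>2 * norm z * exp (- L) \<le> 1 / 2\<close>.\<close>
  define L where "L = \<bar>ln (norm z)\<bar> + ln 4"
  define S where "S = {n::int. \<bar>of_int n * rate\<bar> \<le> L \<and> z * Q (of_int n) \<noteq> 1}"
  have "S \<subseteq> {- \<lceil>L / rate\<rceil>..\<lceil>L / rate\<rceil>}"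
  proof
    fix n assume "n \<in> S"
    then have "\<bar>of_int n\<bar> \<le> L / rate" using rate_pos Im_pos by (simp add: S_def abs_mult field_simps)
    then show "n \<in> {- \<lceil>L / rate\<rceil>..\<lceil>L / rate\<rceil>}" by (simp add: abs_le_iff) linarith
  qed
  then have fin: "finite S" by (rule finite_subset) simp
  \<comment> \<open>Half of the smallest value at the centre; \<open>1 / 2\<close> serves the \<open>n\<close> outside \<open>S\<close>.\<close>
  define \<delta> where "\<delta> = Min (insert (1 / 2) ((\<lambda>n. norm (1 - z * Q (of_int n)) / 2) ` S))"
  have \<delta>: "\<delta> > 0" unfolding \<delta>_def using fin by (subst Min_gr_iff) (auto simp: S_def)
  have \<delta>1: "\<delta> \<le> 1 / 2" unfolding \<delta>_def using fin by (intro Min_le) auto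
  have \<delta>2: "\<delta> \<le> norm (1 - z * Q (of_int n)) / 2" if "n \<in> S" for n
    unfolding \<delta>_def using fin that by (intro Min_le) auto
  have "\<forall>\<^sub>F w in nhds z. \<delta> < norm (1 - w * Q (of_int n))" if "n \<in> S" for n
  proof (rule order_tendstoD(1))
    show "((\<lambda>w. norm (1 - w * Q (of_int n))) \<longlongrightarrow> norm (1 - z * Q (of_int n))) (nhds z)"
      by (intro tendsto_intros filterlim_ident)
    show "\<delta> < norm (1 - z * Q (of_int n))" using \<delta>2[OF that] \<delta> by linarith
  qed
  then have "\<forall>\<^sub>F w in nhds z. \<forall>n\<in>S. \<delta> < norm (1 - w * Q (of_int n))"
    using fin by (simp add: eventually_ball_finite)
  then obtain e where e: "e > 0" "\<And>w. dist w z < e \<Longrightarrow> \<forall>n\<in>S. \<delta> < norm (1 - w * Q (of_int n))"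
    unfolding eventually_nhds_metric by blast
  define r where "r = min (e / 2) (norm z / 2)"
  have "r > 0" using e z by (simp add: r_def)
  have sub: "cball z r \<subseteq> cball z (norm z / 2)" by (rule subset_cball) (simp add: r_def)
  have "\<delta> \<le> norm (1 - w * Q (of_int n))" if w: "w \<in> cball z r" and n: "z * Q (of_int n) \<noteq> 1" for w n
  proof (cases "n \<in> S")
    case True
    have "dist w z < e" using w e by (auto simp: r_def dist_commute)
    then show ?thesis using e(2) True by fastforce
  next
    case False
    then have big: "\<bar>of_int n * rate\<bar> > L" using n by (auto simp: S_def)
    have w': "norm z / 2 \<le> norm w" "norm w \<le> 2 * norm z"
    proof -
      have "norm (z - w) \<le> norm z / 2" using sub w by (auto simp: dist_norm)
      then show "norm z / 2 \<le> norm w" "norm w \<le> 2 * norm z"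
        using norm_triangle_ineq2[of z w] norm_triangle_ineq2[of w z] norm_minus_commute[of z w]
        by linarith+
    qed
    have nQ: "norm (Q (of_int n)) = exp (- (of_int n * rate))" by (simp add: norm_qpow mult.commute)
    show ?thesis
    proof (cases "of_int n * rate > L")
      case True
      have "norm (w * Q (of_int n)) \<le> (2 * norm z) * exp (- L)"
        unfolding norm_mult nQ using w' True by (intro mult_mono) auto
      also have "\<dots> \<le> (2 * norm z) * exp (- (ln (norm z) + ln 4))"
        unfolding L_def by (intro mult_left_mono) auto
      also have "\<dots> = 1 / 2" using z unfolding exp_minus exp_add by simp
      finally show ?thesis using \<delta>1 norm_triangle_ineq2[of 1 "w * Q (of_int n)"] by simp
    next
      case False
      then have "of_int n * rate < - L" using big by linarith
      then have "(norm z / 2) * exp L \<le> norm (w * Q (of_int n))"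
        unfolding norm_mult nQ using w' by (intro mult_mono) auto
      moreover have "(norm z / 2) * exp L \<ge> (norm z / 2) * exp (- ln (norm z) + ln 4)"
        unfolding L_def by (intro mult_left_mono) auto
      moreover have "(norm z / 2) * exp (- ln (norm z) + ln 4) = 2" using z unfolding exp_add exp_minus by simp
      ultimately show ?thesis using \<delta>1 norm_triangle_ineq3[of 1 "w * Q (of_int n)"] by simp
    qed
  qed
  moreover have "cball z r \<subseteq> - {0}" using sub norm_powi_le_exp(1)[OF z] by blast
  ultimately show ?thesis using that \<open>r > 0\<close> \<delta> by blast
qed

lemma appell_summable:
  assumes a: "a summable_on UNIV" and z: "z \<noteq> 0" "z \<notin> qlattice"
  shows "(\<lambda>n. a n / (1 - z * Q (of_int n))) summable_on UNIV"
proof -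
  obtain r \<delta> where r: "r > 0" "\<delta> > 0" 
    and \<delta>: "\<And>w n. w \<in> cball z r \<Longrightarrow> z * Q (of_int n) \<noteq> 1 \<Longrightarrow> \<delta> \<le> norm (1 - w * Q (of_int n))"
    using denominators_bounded_below[OF z(1)] by metis
  show ?thesis
  proof (rule summable_on_boundedI)
    show "(\<lambda>n. norm (a n) * (1 / \<delta>)) summable_on UNIV"
      using a by (intro summable_on_cmult_left) (simp add: summable_on_iff_abs_summable_on_complex)
    fix n
    have "\<delta> \<le> norm (1 - z * Q (of_int n))" using \<delta>[of z n] r z not_qlattice_iff by simp
    then show "norm (a n / (1 - z * Q (of_int n))) \<le> norm (a n) * (1 / \<delta>)"
      using r by (simp add: norm_divide frac_le)
  qed
qed

lemma eventually_not_qlattice: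
  assumes z: "z \<noteq> 0"
  shows "\<forall>\<^sub>F w in at z. w \<noteq> 0 \<and> w \<notin> qlattice"
proof -
  obtain r \<delta> where r: "r > 0" "\<delta> > 0" "cball z r \<subseteq> - {0}"
    and \<delta>: "\<And>w n. w \<in> cball z r \<Longrightarrow> z * Q (of_int n) \<noteq> 1 \<Longrightarrow> \<delta> \<le> norm (1 - w * Q (of_int n))"
    using denominators_bounded_below[OF z] by metis
  have "\<forall>\<^sub>F w in at z. w \<in> ball z r - {z}" using r by (intro eventually_at_in_open) auto
  then show ?thesis
  proof eventually_elim
    case (elim w)
    have "w * Q (of_int n) \<noteq> 1" for n
    proof (cases "z * Q (of_int n) = 1")
      case True
      then show ?thesis using elim by (metis DiffE insertCI mult_right_cancel qpow_nonzero)
    next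
      case False
      then show ?thesis using \<delta>[of w n] r elim by auto
    qed
    moreover have "w \<noteq> 0" using r elim by auto
    ultimately show ?case using not_qlattice_iff by blast
  qed
qed

text \<open>Near \<open>z = q\<^bsup>-N\<^esup>\<close> the sum is \<open>a\<^sub>N / (1 - w q\<^sup>N)\<close> plus a holomorphic function \<open>G\<close>, and the simple pole is
  cancelled by the zero of \<open>\<Theta>\<close>: the product tends to a limit that involves the derivative of \<open>\<Theta>\<close>.\<close>

lemma Theta_appell_removable:
  assumes a: "a summable_on UNIV" and z: "z \<noteq> 0"
  defines "h \<equiv> \<lambda>w. Theta w (Q 1) * (\<Sum>\<^sub>\<infinity>n. a n / (1 - w * Q (of_int n)))"
  shows "z \<notin> qlattice \<Longrightarrow> h analytic_on {z}" and "remove_sings h analytic_on {z}"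
proof -
  obtain r \<delta> where r: "r > 0" "\<delta> > 0" "cball z r \<subseteq> - {0}"
    and \<delta>: "\<And>w n. w \<in> cball z r \<Longrightarrow> z * Q (of_int n) \<noteq> 1 \<Longrightarrow> \<delta> \<le> norm (1 - w * Q (of_int n))"
    using denominators_bounded_below[OF z] by metis
  define I where "I = {n::int. z * Q (of_int n) \<noteq> 1}"
  define G where "G w = (\<Sum>\<^sub>\<infinity>n\<in>I. a n / (1 - w * Q (of_int n)))" for w
  have M: "(\<lambda>n. norm (a n) * (1 / \<delta>)) summable_on I"
  proof (rule summable_on_cmult_left)
    have "(\<lambda>n. norm (a n)) summable_on UNIV"
      using a by (simp add: summable_on_iff_abs_summable_on_complex)
    then show "(\<lambda>n. norm (a n)) summable_on I"
      by (rule summable_on_subset_banach) simp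
  qed
  have bd: "norm (a n / (1 - w * Q (of_int n))) \<le> norm (a n) * (1 / \<delta>)"
    if "w \<in> cball z r" "n \<in> I" for w n
    using \<delta>[OF that(1), of n] that(2) r by (simp add: I_def norm_divide frac_le)
  have G: "G holomorphic_on ball z r"
    unfolding G_def
  proof (rule holomorphic_on_infsum)
    fix n assume n: "n \<in> I"
    have "1 - w * Q (of_int n) \<noteq> 0" if "w \<in> ball z r" for w
      using \<delta>[of w n] n that r by (auto simp: I_def)
    then show "(\<lambda>w. a n / (1 - w * Q (of_int n))) holomorphic_on ball z r"
      by (auto intro!: holomorphic_intros)
  next
    fix w assume "w \<in> ball z r"
    then obtain e where "e > 0" "cball w e \<subseteq> ball z r" using open_contains_cball open_ball by metis
    then show "\<exists>e>0. \<exists>M. cball w e \<subseteq> ball z r \<and> M summable_on I \<and>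
        (\<forall>w\<in>cball w e. \<forall>n\<in>I. norm (a n / (1 - w * Q (of_int n))) \<le> M n)"
      using M bd ball_subset_cball by (meson subsetD)
  qed
  have Th: "(\<lambda>x. Theta x (Q 1)) holomorphic_on ball z r"
    using Theta_holomorphic by (rule holomorphic_on_subset) (use r(3) ball_subset_cball in blast)
  have zin: "z \<in> ball z r" using r by simp
  {
    assume "z \<notin> qlattice"
    then have "I = UNIV" using not_qlattice_iff by (auto simp: I_def)
    then have "h = (\<lambda>w. Theta w (Q 1) * G w)" by (simp add: h_def G_def)
    moreover have "(\<lambda>w. Theta w (Q 1) * G w) holomorphic_on ball z r"
      using Th G by (rule holomorphic_on_mult)
    ultimately show ana: "h analytic_on {z}"
      using zin open_ball by (metis analytic_at)
  } note ana = this
  show "remove_sings h analytic_on {z}"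
  proof (cases "z \<in> qlattice")
    case False
    then show ?thesis using ana remove_sings_analytic_on by blast
  next
    case True
    then obtain N :: int where N: "z * Q (of_int N) = 1" using not_qlattice_iff by blast
    have uniq: "n = N" if "z * Q (of_int n) = 1" for n
    proof -
      have "Q (of_int n) = Q (of_int N)" using that N z by (metis mult_left_cancel)
      then have "norm (Q (of_int n)) = norm (Q (of_int N))" by simp
      then show ?thesis using Im_pos by (simp add: norm_qpow)
    qed
    have UN: "UNIV = {N} \<union> I" "{N} \<inter> I = {}" using uniq N unfolding I_def by blast+
    have hw: "h w = Theta w (Q 1) * G w + a N * (Theta w (Q 1) / (1 - w * Q (of_int N)))" if "w \<in> ball z r" for w
    proof -
      have "(\<lambda>n. a n / (1 - w * Q (of_int n))) summable_on I"
        by (rule summable_on_boundedI[OF M bd]) (use that in auto)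
      then have "(\<Sum>\<^sub>\<infinity>n. a n / (1 - w * Q (of_int n))) = a N / (1 - w * Q (of_int N)) + G w"
        unfolding UN(1) G_def using UN(2) by (subst infsum_Un_disjoint) simp_all
      then show ?thesis by (simp add: h_def algebra_simps)
    qed
    have den: "1 - w * Q (of_int N) = - Q (of_int N) * (w - z)" for w
      using N by (simp add: algebra_simps)
    have holo: "(\<lambda>w. Theta w (Q 1) * G w + a N * (Theta w (Q 1) / (1 - w * Q (of_int N)))) holomorphic_on ball z r - {z}"
      by (intro holomorphic_intros holomorphic_on_subset[OF Th] holomorphic_on_subset[OF G]) (auto simp: den)
    then have "h holomorphic_on ball z r - {z}"
      by (rule holomorphic_transform) (simp add: hw)
    then have iso: "isolated_singularity_at h z"
      using r unfolding isolated_singularity_at_def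
      by (intro exI[of _ r]) (simp add: analytic_on_open open_delete)
    have diff: "((\<lambda>x. Theta x (Q 1)) has_field_derivative deriv (\<lambda>x. Theta x (Q 1)) z) (at z)"
      by (rule holomorphic_derivI[OF Th open_ball zin])
    have "((\<lambda>w. (Theta w (Q 1) - Theta z (Q 1)) / (w - z)) \<longlongrightarrow> deriv (\<lambda>x. Theta x (Q 1)) z) (at z)"
      using diff by (simp add: has_field_derivative_iff)
    then have l1: "((\<lambda>w. Theta w (Q 1) * G w + a N * ((Theta w (Q 1) - Theta z (Q 1)) / (w - z) / - Q (of_int N))) \<longlongrightarrow>
       Theta z (Q 1) * G z + a N * (deriv (\<lambda>x. Theta x (Q 1)) z / - Q (of_int N))) (at z)"
    proof (intro tendsto_intros)
      show "((\<lambda>w. Theta w (Q 1)) \<longlongrightarrow> Theta z (Q 1)) (at z)"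
        using diff DERIV_isCont isContD by blast
      show "(G \<longlongrightarrow> G z) (at z)"
        using holomorphic_on_imp_continuous_on[OF G] zin
        by (simp add: continuous_on_eq_continuous_at[OF open_ball] isContD)
    qed auto
    have "\<forall>\<^sub>F w in at z. w \<in> ball z r - {z}" using r by (intro eventually_at_in_open) auto
    then have "\<forall>\<^sub>F w in at z. Theta w (Q 1) * G w + a N * ((Theta w (Q 1) - Theta z (Q 1)) / (w - z) / - Q (of_int N)) = h w"
      by eventually_elim (simp add: hw den Theta_qlattice[OF True] mult.commute)
    with l1 have "(h \<longlongrightarrow> Theta z (Q 1) * G z + a N * (deriv (\<lambda>x. Theta x (Q 1)) z / - Q (of_int N))) (at z)"
      by (rule Lim_transform_eventually)
    then show ?thesis using iso remove_sings_analytic_at by blast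
  qed
qed

text \<open>The lattice is discrete in the punctured plane, so inequalities between continuous functions pass
  to its points in the limit.\<close>

lemma le_extends_over_qlattice:
  fixes F G :: "complex \<Rightarrow> real"
  assumes "continuous_on (- {0}) F" "continuous_on (- {0}) G"
    and le: "\<And>x. x \<noteq> 0 \<Longrightarrow> x \<notin> qlattice \<Longrightarrow> F x \<le> G x" and x: "x \<noteq> 0"
  shows "F x \<le> G x"
proof (rule tendsto_le[OF at_neq_bot])
  have "open (- {0::complex})" by auto
  then show "(F \<longlongrightarrow> F x) (at x)" "(G \<longlongrightarrow> G x) (at x)"
    using assms(1,2) x by (auto simp: continuous_on_eq_continuous_at isContD)
  show "\<forall>\<^sub>F w in at x. F w \<le> G w"
    using eventually_not_qlattice[OF x] by eventually_elim (use le in auto)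
qed

text \<open>\<open>x q\<^sup>n / (1 - x q\<^sup>n) = 1 / (1 - x q\<^sup>n) - 1\<close>, and the sum of the terms \<open>- 1\<close> vanishes.\<close>

lemma edge_appell_step:
  assumes "x \<noteq> 0" "x \<notin> qlattice"
  shows "x * (\<Sum>\<^sub>\<infinity>n. edge (a + 1) n / (1 - x * Q (of_int n))) = (\<Sum>\<^sub>\<infinity>n. edge a n / (1 - x * Q (of_int n)))"
proof -
  have "x * (edge (a + 1) n / (1 - x * Q (of_int n))) = edge a n / (1 - x * Q (of_int n)) + - edge a n" for n
  proof -
    have "((of_int n)\<^sup>2 + of_int n) / 2 + of_int (a + 1) * of_int n = (((of_int n)\<^sup>2 + of_int n) / 2 + of_int a * of_int n) + (of_int n :: real)"
      by (simp add: algebra_simps)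
    then have "edge (a + 1) n = edge a n * Q (of_int n)" by (simp only: edge_def qpow_add) simp
    moreover have "1 - x * Q (of_int n) \<noteq> 0" using assms not_qlattice_iff by simp
    ultimately show ?thesis by (simp add: field_simps)
  qed
  then have "x * (\<Sum>\<^sub>\<infinity>n. edge (a + 1) n / (1 - x * Q (of_int n))) = (\<Sum>\<^sub>\<infinity>n. edge a n / (1 - x * Q (of_int n)) + - edge a n)"
    by (subst infsum_cmult_right'[symmetric]) simp
  also have "\<dots> = (\<Sum>\<^sub>\<infinity>n. edge a n / (1 - x * Q (of_int n))) + (\<Sum>\<^sub>\<infinity>n. - edge a n)"
    by (intro infsum_add appell_summable edge_summable assms summable_on_uminus[THEN iffD2])
  finally show ?thesis by (simp add: infsum_uminus edge_vanish)
qed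

lemma edge_appell_power:
  assumes "x \<noteq> 0" "x \<notin> qlattice"
  shows "x ^ k * (\<Sum>\<^sub>\<infinity>n. edge (int k) n / (1 - x * Q (of_int n))) = (\<Sum>\<^sub>\<infinity>n. edge 0 n / (1 - x * Q (of_int n)))"
proof (induction k)
  case (Suc k)
  have "x ^ Suc k * (\<Sum>\<^sub>\<infinity>n. edge (int (Suc k)) n / (1 - x * Q (of_int n))) =
     x ^ k * (x * (\<Sum>\<^sub>\<infinity>n. edge (int k + 1) n / (1 - x * Q (of_int n))))"
    by (simp add: add.commute)
  then show ?case using edge_appell_step[OF assms] Suc.IH by simp
qed simp

text \<open>Reindexing and one step in \<open>a\<close> show that the sum is multiplied by \<open>- x\<close> under \<open>x \<mapsto> q x\<close>, while
  \<open>\<Theta>\<close> is multiplied by \<open>- 1 / x\<close>. The product is invariant and extends holomorphically, so one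
  annulus bounds it.\<close>

lemma Theta_edge_appell_bounded:
  obtains C where "\<And>x. x \<noteq> 0 \<Longrightarrow> x \<notin> qlattice \<Longrightarrow>
    norm (Theta x (Q 1) * (\<Sum>\<^sub>\<infinity>n. edge 0 n / (1 - x * Q (of_int n)))) \<le> C"
proof -
  define h where "h x = Theta x (Q 1) * (\<Sum>\<^sub>\<infinity>n. edge 0 n / (1 - x * Q (of_int n)))" for x
  have ana: "h analytic_on {z}" if "z \<noteq> 0" "z \<notin> qlattice" for z
    using Theta_appell_removable(1)[OF edge_summable that] unfolding h_def[abs_def] .
  have "remove_sings h analytic_on - {0}"
    using Theta_appell_removable(2)[OF edge_summable] unfolding h_def[abs_def]
    by (subst analytic_on_analytic_at) auto
  then have hol: "remove_sings h holomorphic_on - {0}" by (rule analytic_imp_holomorphic)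
  have per: "h (Q 1 * x) = h x" if x: "x \<noteq> 0" "x \<notin> qlattice" for x
  proof -
    have "(\<Sum>\<^sub>\<infinity>n. edge 0 n / (1 - Q 1 * x * Q (of_int n))) = (\<Sum>\<^sub>\<infinity>n. - (edge (- 1) n / (1 - x * Q (of_int n))))"
    proof (rule infsum_reindex_bij_witness[of _ "\<lambda>n. n - 1" "\<lambda>n. n + 1"])
      fix n :: int
      have "((of_int (n + 1))\<^sup>2 + of_int (n + 1)) / 2 + of_int (- 1) * of_int (n + 1) = ((of_int n)\<^sup>2 + of_int n) / 2 + of_int 0 * (of_int n :: real)"
        by (simp add: power2_eq_square field_simps)
      moreover have "(- 1 :: complex) powi (n + 1) = - ((- 1) powi n)" by (simp add: power_int_add)
      ultimately have "edge (- 1) (n + 1) = - edge 0 n" by (simp only: edge_def) simp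
      then show "- (edge (- 1) (n + 1) / (1 - x * Q (of_int (n + 1)))) = edge 0 n / (1 - Q 1 * x * Q (of_int n))"
        by (simp add: qpow_add mult_ac)
    qed auto
    also have "\<dots> = - (\<Sum>\<^sub>\<infinity>n. edge (- 1) n / (1 - x * Q (of_int n)))" by (rule infsum_uminus)
    also have "\<dots> = - x * (\<Sum>\<^sub>\<infinity>n. edge 0 n / (1 - x * Q (of_int n)))"
      using edge_appell_step[OF x, of "- 1"] by simp
    finally show ?thesis using x by (simp add: h_def Theta_shift)
  qed
  have cont: "continuous_on (- {0}) (remove_sings h)" using hol by (rule holomorphic_on_imp_continuous_on)
  have "norm (remove_sings h (Q 1 * x) - remove_sings h x) \<le> 0" if "x \<noteq> 0" for x
  proof (rule le_extends_over_qlattice[OF _ _ _ that])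
    show "continuous_on (- {0}) (\<lambda>x. norm (remove_sings h (Q 1 * x) - remove_sings h x))"
      by (intro continuous_intros cont continuous_on_compose2[OF cont]) auto
    show "norm (remove_sings h (Q 1 * x) - remove_sings h x) \<le> 0" if "x \<noteq> 0" "x \<notin> qlattice" for x
    proof -
      have "remove_sings h x = h x" "remove_sings h (Q 1 * x) = h (Q 1 * x)"
        using that ana qlattice_shift by simp_all
      then show ?thesis using per that by simp
    qed
  qed auto
  then obtain C where C: "\<And>x. x \<noteq> 0 \<Longrightarrow> norm (remove_sings h x) \<le> C"
    using q_periodic_bounded[OF hol norm_Q1] by auto
  have "norm (h x) \<le> C" if "x \<noteq> 0" "x \<notin> qlattice" for x
    using C[OF that(1)] ana[OF that] by simp
  then show ?thesis using that unfolding h_def by blast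
qed

end

section \<open>The Hecke-type double sum as an Appell-type sum\<close>

locale hecke = nome +
  fixes t m :: int
  assumes t2: "2 \<le> t" and m1: "1 \<le> m" and mt: "m < t"
begin

text \<open>The summand of \<open>g\<close> in the coordinates \<open>n = (r + s) / 2\<close>, \<open>j = (r - s) / 2\<close>, in which the denominator
  depends on \<open>n\<close> alone.\<close>

definition hterm :: "int \<Rightarrow> int \<Rightarrow> complex" where
  "hterm n j = (- 1) powi j *
    Q (of_int t * (of_int n)\<^sup>2 + of_int t * of_int n - (of_int t - 1 / 2) * (of_int j)\<^sup>2
       + (of_int t - 1 / 2 - of_int m) * of_int j)"

text \<open>The \<open>j\<close> for which \<open>n + j\<close> and \<open>n - j\<close> lie on the same side of the sign function; since \<open>sg 0 = 1\<close>,
  the interval is closed for \<open>n \<ge> 0\<close> and loses its end points for \<open>n < 0\<close>.\<close>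

definition cone :: "int \<Rightarrow> int set" where
  "cone n = (if n \<ge> 0 then {- n..n} else {n + 1..- n - 1})"

definition hcoeff :: "int \<Rightarrow> complex" where
  "hcoeff n = sg n * (\<Sum>j\<in>cone n. hterm n j)"

definition \<Phi> :: "int \<Rightarrow> complex" where
  "\<Phi> l = (\<Sum>\<^sub>\<infinity>n. hcoeff n * Q (of_int l * of_int n))"

lemma sg2_cone: "sg2 (n + j) (n - j) = (if j \<in> cone n then sg n else 0)"
  by (auto simp: sg2_def sg_def cone_def)

text \<open>The quadratic form \<open>t n\<^sup>2 - (t - 1/2) j\<^sup>2\<close> is indefinite, but on the cone \<open>j\<^sup>2 \<le> n\<^sup>2\<close> it exceeds
  \<open>(n\<^sup>2 + j\<^sup>2) / 4\<close> by \<open>(t - 1/4) (n\<^sup>2 - j\<^sup>2)\<close>.\<close>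

lemma hterm_bound:
  assumes "j \<in> cone n"
  shows "norm (hterm n j) \<le>
    exp (- (rate / 4) * ((of_int n)\<^sup>2 + (of_int j)\<^sup>2) + rate * of_int t * (\<bar>of_int n\<bar> + \<bar>of_int j\<bar>))"
proof -
  define n' j' t' m' :: real where "n' = of_int n" and "j' = of_int j" and "t' = of_int t" and "m' = of_int m"
  have "\<bar>j\<bar> \<le> \<bar>n\<bar>" using assms by (auto simp: cone_def split: if_splits)
  then have "\<bar>j'\<bar> \<le> \<bar>n'\<bar>" by (simp add: n'_def j'_def)
  then have sq: "j'\<^sup>2 \<le> n'\<^sup>2" by (rule abs_le_square_iff[THEN iffD1])
  have tm: "2 \<le> t'" "1 \<le> m'" "m' \<le> t' - 1" using t2 m1 mt by (simp_all add: t'_def m'_def)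
  have "0 \<le> (t' - 1 / 4) * (n'\<^sup>2 - j'\<^sup>2)" using sq tm by simp
  moreover have "- (t' * n') \<le> t' * \<bar>n'\<bar>"
    using tm by (metis abs_ge_minus_self abs_mult abs_of_nonneg order_trans zero_le_numeral)
  moreover have "- ((t' - 1 / 2 - m') * j') \<le> t' * \<bar>j'\<bar>"
  proof -
    have "- ((t' - 1 / 2 - m') * j') \<le> \<bar>t' - 1 / 2 - m'\<bar> * \<bar>j'\<bar>"
      by (metis abs_ge_minus_self abs_mult)
    also have "\<dots> \<le> t' * \<bar>j'\<bar>" using tm by (intro mult_right_mono) auto
    finally show ?thesis .
  qed
  moreover define X where "X = t' * n'\<^sup>2 + t' * n' - (t' - 1 / 2) * j'\<^sup>2 + (t' - 1 / 2 - m') * j'"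
  ultimately have "- X \<le> - (1 / 4) * (n'\<^sup>2 + j'\<^sup>2) + t' * (\<bar>n'\<bar> + \<bar>j'\<bar>)"
    by (simp add: algebra_simps)
  then have "rate * - X \<le> rate * (- (1 / 4) * (n'\<^sup>2 + j'\<^sup>2) + t' * (\<bar>n'\<bar> + \<bar>j'\<bar>))"
    using rate_pos by (intro mult_left_mono) auto
  also have "\<dots> = - (rate / 4) * (n'\<^sup>2 + j'\<^sup>2) + rate * t' * (\<bar>n'\<bar> + \<bar>j'\<bar>)"
    by (simp add: algebra_simps)
  finally have "rate * - X \<le> - (rate / 4) * (n'\<^sup>2 + j'\<^sup>2) + rate * t' * (\<bar>n'\<bar> + \<bar>j'\<bar>)" .
  moreover have "hterm n j = (- 1) powi j * Q X"
    by (simp add: hterm_def X_def n'_def j'_def t'_def m'_def)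
  then have "norm (hterm n j) = exp (rate * - X)"
    by (simp add: norm_mult norm_power_int norm_qpow)
  ultimately show ?thesis by (simp add: n'_def j'_def t'_def)
qed

text \<open>Fubini for the double sum, with an arbitrary factor depending on \<open>n\<close> only. It is used with the
  denominators of \<open>g\<close> and with the powers \<open>q\<^bsup>ln\<^esup>\<close> that distinguish the sums \<open>\<theta>\<close>.\<close>

lemma hecke_sum:
  assumes c: "\<And>n. norm (c n) \<le> C * exp (B * \<bar>of_int n\<bar>)" and B: "B \<ge> 0"
  shows "(\<lambda>n. hcoeff n * c n) summable_on UNIV"
    and "(\<Sum>\<^sub>\<infinity>(r, s) \<in> {(r, s). [r = s] (mod 2)}. sg2 r s * ((- 1) powi ((r - s) div 2) *
         Q (of_int r ^ 2 / 8 + (4 * of_int t - 1) / 4 * of_int r * of_int s + of_int s ^ 2 / 8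
                  + (4 * of_int t - 1 - 2 * of_int m) / 4 * of_int r
                  + (1 + 2 * of_int m) / 4 * of_int s)) * c ((r + s) div 2)) = (\<Sum>\<^sub>\<infinity>n. hcoeff n * c n)"
proof -
  define F where "F = (\<lambda>(n, j). sg2 (n + j) (n - j) * hterm n j * c n)"
  have C: "0 \<le> C" using order_trans[OF norm_ge_zero c[of 0]] by simp
  define b where "b = rate * of_int t + B"
  have "F summable_on UNIV"
  proof (rule summable_on_boundedI)
    show "(\<lambda>x. C * (case x of (r::int, l::int) \<Rightarrow> exp (- (rate / 4) * ((of_int r)\<^sup>2 + (of_int l)\<^sup>2) + b * (\<bar>of_int r\<bar> + \<bar>of_int l\<bar>)))) summable_on UNIV"
      using rate_pos by (intro summable_on_cmult_right summable_on_gauss2) simp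
    fix x :: "int \<times> int"
    obtain n j where x: "x = (n, j)" by (cases x)
    show "norm (F x) \<le> C * (case x of (r::int, l::int) \<Rightarrow> exp (- (rate / 4) * ((of_int r)\<^sup>2 + (of_int l)\<^sup>2) + b * (\<bar>of_int r\<bar> + \<bar>of_int l\<bar>)))"
    proof (cases "j \<in> cone n")
      case True
      have "norm (F x) = norm (hterm n j) * norm (c n)"
        using True by (simp add: F_def x sg2_cone norm_mult sg_def)
      also have "\<dots> \<le> exp (- (rate / 4) * ((of_int n)\<^sup>2 + (of_int j)\<^sup>2) + rate * of_int t * (\<bar>of_int n\<bar> + \<bar>of_int j\<bar>))
          * (C * exp (B * (\<bar>of_int n\<bar> + \<bar>of_int j\<bar>)))"
      proof (rule mult_mono[OF hterm_bound[OF True] order_trans[OF c]])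
        show "C * exp (B * \<bar>of_int n\<bar>) \<le> C * exp (B * (\<bar>of_int n\<bar> + \<bar>of_int j\<bar>))"
          using C B by (intro mult_left_mono) (simp_all add: mult_left_mono)
      qed auto
      also have "\<dots> = C * (case x of (r::int, l::int) \<Rightarrow> exp (- (rate / 4) * ((of_int r)\<^sup>2 + (of_int l)\<^sup>2) + b * (\<bar>of_int r\<bar> + \<bar>of_int l\<bar>)))"
        by (simp add: x b_def exp_add[symmetric] algebra_simps)
      finally show ?thesis .
    qed (use C in \<open>simp add: F_def x sg2_cone\<close>)
  qed
  then have F: "F summable_on UNIV \<times> UNIV" by simp
  have inner: "(\<Sum>\<^sub>\<infinity>j. F (n, j)) = hcoeff n * c n" for n
  proof -
    have "(\<Sum>\<^sub>\<infinity>j. F (n, j)) = (\<Sum>\<^sub>\<infinity>j\<in>cone n. sg n * hterm n j * c n)"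
      by (rule infsum_cong_neutral) (auto simp: F_def sg2_cone)
    also have "\<dots> = hcoeff n * c n"
      by (subst infsum_finite) (auto simp: cone_def hcoeff_def sum_distrib_left sum_distrib_right)
    finally show ?thesis .
  qed
  have "(\<lambda>n. \<Sum>\<^sub>\<infinity>j. F (n, j)) summable_on UNIV"
    by (rule summable_on_Sigma_banach) (use F in simp)
  then show "(\<lambda>n. hcoeff n * c n) summable_on UNIV" by (simp add: inner)
  have "(\<Sum>\<^sub>\<infinity>n. hcoeff n * c n) = infsum F (UNIV \<times> UNIV)"
    unfolding inner[symmetric] using F by (rule infsum_Sigma_banach)
  also have "\<dots> = (\<Sum>\<^sub>\<infinity>(r, s) \<in> {(r, s). [r = s] (mod 2)}. sg2 r s * ((- 1) powi ((r - s) div 2) *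
         Q (of_int r ^ 2 / 8 + (4 * of_int t - 1) / 4 * of_int r * of_int s + of_int s ^ 2 / 8
                  + (4 * of_int t - 1 - 2 * of_int m) / 4 * of_int r
                  + (1 + 2 * of_int m) / 4 * of_int s)) * c ((r + s) div 2))" (is "_ = infsum ?G ?S")
  proof (rule infsum_reindex_bij_witness[of _ "\<lambda>(r, s). ((r + s) div 2, (r - s) div 2)" "\<lambda>(n, j). (n + j, n - j)"])
    fix b assume "b \<in> ?S"
    then obtain r s where b: "b = (r, s)" "r mod 2 = s mod 2" by (auto simp: cong_def)
    then show "(case case b of (r, s) \<Rightarrow> ((r + s) div 2, (r - s) div 2) of (n, j) \<Rightarrow> (n + j, n - j)) = b"
      by simp presburger
  next
    fix a :: "int \<times> int"
    obtain n j where a: "a = (n, j)" by (cases a)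
    show "(case a of (n, j) \<Rightarrow> (n + j, n - j)) \<in> ?S"
      by (simp add: a cong_iff_dvd_diff)
    have "(of_int (n + j))\<^sup>2 / 8 + (4 * of_int t - 1) / 4 * of_int (n + j) * of_int (n - j) + (of_int (n - j))\<^sup>2 / 8
                  + (4 * of_int t - 1 - 2 * of_int m) / 4 * of_int (n + j)
                  + (1 + 2 * of_int m) / 4 * of_int (n - j) =
       of_int t * (of_int n)\<^sup>2 + of_int t * of_int n - (of_int t - 1 / 2) * (of_int j)\<^sup>2
       + (of_int t - 1 / 2 - of_int m) * (of_int j :: real)"
      by (simp add: power2_eq_square field_simps)
    then show "?G (case a of (n, j) \<Rightarrow> (n + j, n - j)) = F a"
      by (simp only: a F_def hterm_def prod.case) simp
  qed auto
  finally show "infsum ?G ?S = (\<Sum>\<^sub>\<infinity>n. hcoeff n * c n)" ..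
qed

lemma hcoeff_Q_summable: "(\<lambda>n. hcoeff n * Q (of_int l * of_int n)) summable_on UNIV"
  and theta_eq: "theta \<tau> t (t + l) (m + l) = \<Phi> l"
proof -
  have c: "norm (Q (of_int l * of_int n)) \<le> 1 * exp ((rate * \<bar>of_int l\<bar>) * \<bar>of_int n\<bar>)" for n
  proof -
    have "- (rate * (of_int l * of_int n)) \<le> \<bar>rate * (of_int l * of_int n)\<bar>" by (rule abs_ge_minus_self)
    also have "\<dots> = (rate * \<bar>of_int l\<bar>) * \<bar>of_int n\<bar>" using Im_pos by (simp add: abs_mult)
    finally show ?thesis by (simp add: norm_qpow)
  qed
  have B: "rate * \<bar>of_int l\<bar> \<ge> 0" using Im_pos by (intro mult_nonneg_nonneg) auto
  show "(\<lambda>n. hcoeff n * Q (of_int l * of_int n)) summable_on UNIV"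
    by (rule hecke_sum(1)[OF c B])
  have "\<Phi> l = (\<Sum>\<^sub>\<infinity>(r, s) \<in> {(r, s). [r = s] (mod 2)}. sg2 r s * ((- 1) powi ((r - s) div 2) *
         Q (of_int r ^ 2 / 8 + (4 * of_int t - 1) / 4 * of_int r * of_int s + of_int s ^ 2 / 8
                  + (4 * of_int t - 1 - 2 * of_int m) / 4 * of_int r
                  + (1 + 2 * of_int m) / 4 * of_int s)) * Q (of_int l * of_int ((r + s) div 2)))"
    unfolding \<Phi>_def by (rule hecke_sum(2)[OF c B, symmetric])
  also have "\<dots> = theta \<tau> t (t + l) (m + l)"
    unfolding theta_def
  proof (rule infsum_cong)
    fix x :: "int \<times> int" assume "x \<in> {(r, s). [r = s] (mod 2)}"
    then obtain r s where x: "x = (r, s)" and "r mod 2 = s mod 2" by (auto simp: cong_def)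
    then have "even (r + s)" by presburger
    then have h: "of_int ((r + s) div 2) = (of_int r + of_int s) / (2::real)"
      by (simp add: real_of_int_div)
    show "(case x of (r, s) \<Rightarrow> sg2 r s * ((- 1) powi ((r - s) div 2) *
         Q (of_int r ^ 2 / 8 + (4 * of_int t - 1) / 4 * of_int r * of_int s + of_int s ^ 2 / 8
                  + (4 * of_int t - 1 - 2 * of_int m) / 4 * of_int r
                  + (1 + 2 * of_int m) / 4 * of_int s)) * Q (of_int l * of_int ((r + s) div 2))) =
      (case x of (r, s) \<Rightarrow> sg2 r s * (- 1) powi ((r - s) div 2) *
         Q (of_int r ^ 2 / 8 + (4 * of_int t - 1) / 4 * of_int r * of_int s + of_int s ^ 2 / 8
                  + (4 * of_int (t + l) - 1 - 2 * of_int (m + l)) / 4 * of_int r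
                  + (1 + 2 * of_int (m + l)) / 4 * of_int s))"
      unfolding x prod.case h mult.assoc qpow_add[symmetric]
      by (intro arg_cong2[of _ _ _ _ "(*)"] refl arg_cong[where f = Q]) (simp add: field_simps)
  qed
  finally show "theta \<tau> t (t + l) (m + l) = \<Phi> l" ..
qed

lemma hcoeff_summable: "hcoeff summable_on UNIV"
  using hcoeff_Q_summable[of 0] by simp

lemma g_eq:
  assumes z: "z \<noteq> 0"
  shows "g_fun \<tau> t m z = (\<Sum>\<^sub>\<infinity>n. hcoeff n / (1 - z * Q (of_int n)))"
proof -
  obtain r \<delta> where r: "r > 0" "\<delta> > 0" "cball z r \<subseteq> - {0}"
    and \<delta>: "\<And>w n. w \<in> cball z r \<Longrightarrow> z * Q (of_int n) \<noteq> 1 \<Longrightarrow> \<delta> \<le> norm (1 - w * Q (of_int n))"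
    using denominators_bounded_below[OF z] by metis
  have c: "norm (1 / (1 - z * Q (of_int n))) \<le> (1 / \<delta>) * exp (0 * \<bar>of_int n\<bar>)" for n
  proof (cases "z * Q (of_int n) = 1")
    case False
    then have "\<delta> \<le> norm (1 - z * Q (of_int n))" using \<delta>[of z n] r by simp
    then show ?thesis using r by (simp add: norm_divide frac_le)
  qed (use r in simp)
  have "(\<Sum>\<^sub>\<infinity>n. hcoeff n * (1 / (1 - z * Q (of_int n)))) = g_fun \<tau> t m z"
    unfolding g_fun_def
  proof (subst hecke_sum(2)[OF c order_refl, symmetric], rule infsum_cong)
    fix x :: "int \<times> int" assume "x \<in> {(r, s). [r = s] (mod 2)}"
    then obtain r s where x: "x = (r, s)" and "r mod 2 = s mod 2" by (auto simp: cong_def)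
    then have "even (r + s)" by presburger
    then have h: "of_int ((r + s) div 2) = (of_int r + of_int s) / (2::real)"
      by (simp add: real_of_int_div)
    show "(case x of (r, s) \<Rightarrow> sg2 r s * ((- 1) powi ((r - s) div 2) *
         Q (of_int r ^ 2 / 8 + (4 * of_int t - 1) / 4 * of_int r * of_int s + of_int s ^ 2 / 8
                  + (4 * of_int t - 1 - 2 * of_int m) / 4 * of_int r
                  + (1 + 2 * of_int m) / 4 * of_int s)) * (1 / (1 - z * Q (of_int ((r + s) div 2))))) =
      (case x of (r, s) \<Rightarrow> sg2 r s * ((- 1) powi ((r - s) div 2) *
         Q (of_int r ^ 2 / 8 + (4 * of_int t - 1) / 4 * of_int r * of_int s + of_int s ^ 2 / 8
                  + (4 * of_int t - 1 - 2 * of_int m) / 4 * of_int r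
                  + (1 + 2 * of_int m) / 4 * of_int s)) / (1 - z * Q ((of_int r + of_int s) / 2)))"
      unfolding x prod.case h by simp
  qed
  then show ?thesis by simp
qed

lemma hterm_step: "Q (2 * of_int t * of_int n) * hterm (n - 1) j = hterm n j"
proof -
  have "of_int t * (of_int n)\<^sup>2 + of_int t * of_int n - (of_int t - 1 / 2) * (of_int j)\<^sup>2
       + (of_int t - 1 / 2 - of_int m) * of_int j =
     2 * of_int t * of_int n + (of_int t * (of_int (n - 1))\<^sup>2 + of_int t * of_int (n - 1) - (of_int t - 1 / 2) * (of_int j)\<^sup>2
       + (of_int t - 1 / 2 - of_int m) * (of_int j :: real))"
    by (simp add: power2_eq_square algebra_simps)
  then show ?thesis unfolding hterm_def by (simp only: qpow_add mult.left_commute)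
qed

text \<open>Under multiplication by \<open>q\<^bsup>2tn\<^esup>\<close> the summand at \<open>n - 1\<close> becomes the summand at \<open>n\<close> with the same \<open>j\<close>, so
  only the two end points \<open>j = \<plusminus> n\<close> of the cone remain. For \<open>n < 0\<close> the cone shrinks instead of
  growing, which the sign compensates; at \<open>n = 0\<close> the two end points coincide and the sign
  flips while the cone stays \<open>{0}\<close>.\<close>

lemma hcoeff_step: "hcoeff n = edge (2 * t - 1 - m) n + edge m n + Q (2 * of_int t * of_int n) * hcoeff (n - 1)"
proof -
  have e1: "hterm n n = edge (2 * t - 1 - m) n"
    unfolding hterm_def edge_def
    by (intro arg_cong2[of _ _ _ _ "(*)"] refl arg_cong[where f = Q]) (simp add: power2_eq_square algebra_simps add_divide_distrib)
  have e2: "hterm n (- n) = edge m n"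
  proof -
    have "(- 1 :: complex) powi (- n) = (- 1) powi n" by (simp add: power_int_minus_left)
    then show ?thesis unfolding hterm_def edge_def
      by (intro arg_cong2[of _ _ _ _ "(*)"] arg_cong[where f = Q]) (simp_all add: power2_eq_square algebra_simps add_divide_distrib)
  qed
  have s: "Q (2 * of_int t * of_int n) * hcoeff (n - 1) = sg (n - 1) * (\<Sum>j\<in>cone (n - 1). hterm n j)"
    by (simp add: hcoeff_def hterm_step sum_distrib_left mult.left_commute[of "Q _"])
  consider "n \<ge> 1" | "n = 0" | "n < 0" by linarith
  then have "sg n * (\<Sum>j\<in>cone n. hterm n j) = hterm n n + hterm n (- n) + sg (n - 1) * (\<Sum>j\<in>cone (n - 1). hterm n j)"
  proof cases
    case 1
    then have "cone n = insert n (insert (- n) (cone (n - 1)))" "n \<notin> insert (- n) (cone (n - 1))" "- n \<notin> cone (n - 1)" "finite (cone (n - 1))"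
      by (auto simp: cone_def)
    then show ?thesis using 1 by (simp add: sg_def)
  next
    case 2
    then have "cone n = {0}" "cone (n - 1) = {0}" by (auto simp: cone_def)
    then show ?thesis using 2 by (simp add: sg_def)
  next
    case 3
    then have "cone (n - 1) = insert n (insert (- n) (cone n))" "n \<notin> insert (- n) (cone n)" "- n \<notin> cone n" "finite (cone n)"
      by (auto simp: cone_def)
    then show ?thesis using 3 by (simp add: sg_def)
  qed
  then show ?thesis by (simp add: s e1 e2 flip: hcoeff_def)
qed

lemma shifted_hcoeff_summable: "(\<lambda>n. hcoeff (n - 1) * Q (of_int i * of_int n)) summable_on UNIV"
  and shifted_hcoeff_sum: "(\<Sum>\<^sub>\<infinity>n. hcoeff (n - 1) * Q (of_int i * of_int n)) = Q (of_int i) * \<Phi> i"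
proof -
  have "(\<lambda>n. Q (of_int i) * (hcoeff n * Q (of_int i * of_int n))) summable_on UNIV"
    by (intro summable_on_cmult_right hcoeff_Q_summable)
  moreover have eq: "Q (of_int i) * (hcoeff (n - 1) * Q (of_int i * of_int (n - 1))) = hcoeff (n - 1) * Q (of_int i * of_int n)" for n
  proof -
    have "of_int i * of_int n = of_int i + of_int i * (of_int (n - 1) :: real)" by (simp add: algebra_simps)
    then show ?thesis by (simp only: qpow_add mult.left_commute)
  qed
  moreover have bij: "bij_betw (\<lambda>n::int. n - 1) UNIV UNIV"
    by (rule bij_betwI[of _ _ _ "\<lambda>n. n + 1"]) auto
  ultimately show "(\<lambda>n. hcoeff (n - 1) * Q (of_int i * of_int n)) summable_on UNIV"
    using summable_on_reindex_bij_betw[OF bij, of "\<lambda>n. Q (of_int i) * (hcoeff n * Q (of_int i * of_int n))"]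
    by (simp only: eq)
  have "(\<Sum>\<^sub>\<infinity>n. hcoeff (n - 1) * Q (of_int i * of_int n)) = (\<Sum>\<^sub>\<infinity>n. Q (of_int i) * (hcoeff n * Q (of_int i * of_int n)))"
    using infsum_reindex_bij_betw[OF bij, of "\<lambda>n. Q (of_int i) * (hcoeff n * Q (of_int i * of_int n))"] by (simp only: eq)
  also have "\<dots> = Q (of_int i) * \<Phi> i" unfolding \<Phi>_def by (rule infsum_cmult_right')
  finally show "(\<Sum>\<^sub>\<infinity>n. hcoeff (n - 1) * Q (of_int i * of_int n)) = Q (of_int i) * \<Phi> i" .
qed

text \<open>The recurrence for the coefficients, summed against \<open>q\<^bsup>ln\<^esup>\<close>: the boundary terms sum to zero.\<close>

lemma \<Phi>_shift: "\<Phi> l = Q (of_int (l + 2 * t)) * \<Phi> (l + 2 * t)"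
proof -
  have e: "edge a n * Q (of_int l * of_int n) = edge (a + l) n" for a n
  proof -
    have "((of_int n)\<^sup>2 + of_int n) / 2 + of_int (a + l) * of_int n = ((of_int n)\<^sup>2 + of_int n) / 2 + of_int a * of_int n + of_int l * (of_int n :: real)"
      by (simp add: algebra_simps)
    then show ?thesis by (simp only: edge_def qpow_add mult.assoc)
  qed
  have "hcoeff n * Q (of_int l * of_int n) = (edge (2 * t - 1 - m + l) n + edge (m + l) n) + hcoeff (n - 1) * Q (of_int (l + 2 * t) * of_int n)" for n
  proof -
    have "of_int (l + 2 * t) * of_int n = 2 * of_int t * of_int n + of_int l * (of_int n :: real)"
      by (simp add: algebra_simps)
    then have "Q (of_int (l + 2 * t) * of_int n) = Q (2 * of_int t * of_int n) * Q (of_int l * of_int n)"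
      by (simp only: qpow_add)
    then show ?thesis by (subst hcoeff_step) (simp only: e[symmetric] ring_distribs mult_ac)
  qed
  then have "\<Phi> l = (\<Sum>\<^sub>\<infinity>n. (edge (2 * t - 1 - m + l) n + edge (m + l) n) + hcoeff (n - 1) * Q (of_int (l + 2 * t) * of_int n))"
    by (simp add: \<Phi>_def)
  also have "\<dots> = (\<Sum>\<^sub>\<infinity>n. edge (2 * t - 1 - m + l) n) + (\<Sum>\<^sub>\<infinity>n. edge (m + l) n)
       + (\<Sum>\<^sub>\<infinity>n. hcoeff (n - 1) * Q (of_int (l + 2 * t) * of_int n))"
    by (simp only: infsum_add summable_on_add edge_summable shifted_hcoeff_summable)
  finally show ?thesis by (simp only: edge_vanish shifted_hcoeff_sum) simp
qed

definition M :: nat where "M = nat (2 * t)"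

lemma int_M: "int M = 2 * t" using t2 by (simp add: M_def)

text \<open>The finite geometric sum \<open>1 / (1 - y) = \<Sum>\<^bsub>i<2t\<^esub> y\<^sup>i + y\<^bsup>2t\<^esup> / (1 - y)\<close> at \<open>y = x q\<^sup>n\<close> produces the factor
  \<open>q\<^bsup>2tn\<^esup>\<close> to which the recurrence applies.\<close>

lemma g_functional_equation:
  assumes x: "x \<noteq> 0" "x \<notin> qlattice"
  shows "g_fun \<tau> t m (Q 1 * x) = (\<Sum>i<M. x ^ i * \<Phi> (int i - 2 * t)) + x ^ M * g_fun \<tau> t m x
    - x ^ M * ((\<Sum>\<^sub>\<infinity>n. edge (2 * t - 1 - m) n / (1 - x * Q (of_int n))) + (\<Sum>\<^sub>\<infinity>n. edge m n / (1 - x * Q (of_int n))))"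
proof -
  let ?d = "\<lambda>n. 1 - x * Q (of_int n)"
  have T: "(\<Sum>\<^sub>\<infinity>n. hcoeff (n - 1) * Q (of_int (int i) * of_int n)) = \<Phi> (int i - 2 * t)" for i
    using \<Phi>_shift[of "int i - 2 * t"] shifted_hcoeff_sum[of "int i"] by simp
  have "g_fun \<tau> t m (Q 1 * x) = (\<Sum>\<^sub>\<infinity>n. hcoeff (n - 1) / ?d n)"
  proof -
    have "(\<Sum>\<^sub>\<infinity>n. hcoeff n / (1 - Q 1 * x * Q (of_int n))) = (\<Sum>\<^sub>\<infinity>n. hcoeff (n - 1) / ?d n)"
      by (rule infsum_reindex_bij_witness[of _ "\<lambda>n. n - 1" "\<lambda>n. n + 1"]) (auto simp: qpow_add mult_ac)
    then show ?thesis using x by (simp add: g_eq)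
  qed
  also have "\<dots> = (\<Sum>\<^sub>\<infinity>n. (\<Sum>i<M. x ^ i * (hcoeff (n - 1) * Q (of_int (int i) * of_int n)))
      + (x ^ M * (hcoeff n / ?d n) + - (x ^ M) * (edge (2 * t - 1 - m) n / ?d n + edge m n / ?d n)))"
  proof (rule infsum_cong)
    fix n :: int
    have d: "?d n \<noteq> 0" using x not_qlattice_iff by simp
    define y where "y = x * Q (of_int n)"
    have y: "y \<noteq> 1" using d by (simp add: y_def)
    have pow: "y ^ i = x ^ i * Q (of_int (int i) * of_int n)" for i
      by (simp add: y_def power_mult_distrib qpow_power)
    have "Q (of_int (int M) * of_int n) = Q (2 * of_int t * of_int n)" by (simp add: int_M)
    then have yM: "y ^ M * hcoeff (n - 1) = x ^ M * (hcoeff n - edge (2 * t - 1 - m) n - edge m n)"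
      using hcoeff_step[of n] unfolding pow by (simp add: algebra_simps)
    have "hcoeff (n - 1) / (1 - y) = (\<Sum>i<M. y ^ i) * hcoeff (n - 1) + y ^ M * hcoeff (n - 1) / (1 - y)"
      using y by (simp add: geometric_sum field_simps)
    then show "hcoeff (n - 1) / ?d n = (\<Sum>i<M. x ^ i * (hcoeff (n - 1) * Q (of_int (int i) * of_int n)))
      + (x ^ M * (hcoeff n / ?d n) + - (x ^ M) * (edge (2 * t - 1 - m) n / ?d n + edge m n / ?d n))"
      unfolding yM y_def[symmetric]
      by (simp add: pow sum_distrib_left sum_distrib_right mult_ac algebra_simps diff_divide_distrib add_divide_distrib)
  qed
  also have "\<dots> = (\<Sum>\<^sub>\<infinity>n. (\<Sum>i<M. x ^ i * (hcoeff (n - 1) * Q (of_int (int i) * of_int n))))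
     + ((\<Sum>\<^sub>\<infinity>n. x ^ M * (hcoeff n / ?d n)) + (\<Sum>\<^sub>\<infinity>n. - (x ^ M) * (edge (2 * t - 1 - m) n / ?d n + edge m n / ?d n)))"
    by (intro infsum_add[THEN trans] arg_cong2[of _ _ _ _ "(+)"] refl infsum_add summable_on_add infsum_finite_sum(1)
        finite_lessThan summable_on_cmult_right shifted_hcoeff_summable appell_summable edge_summable hcoeff_summable x)
  also have "(\<Sum>\<^sub>\<infinity>n. (\<Sum>i<M. x ^ i * (hcoeff (n - 1) * Q (of_int (int i) * of_int n)))) = (\<Sum>i<M. x ^ i * \<Phi> (int i - 2 * t))"
    by (subst infsum_finite_sum(2)) (simp_all only: finite_lessThan summable_on_cmult_right shifted_hcoeff_summable infsum_cmult_right' T)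
  also have "(\<Sum>\<^sub>\<infinity>n. x ^ M * (hcoeff n / ?d n)) = x ^ M * g_fun \<tau> t m x"
    unfolding g_eq[OF x(1)] by (rule infsum_cmult_right')
  also have "(\<Sum>\<^sub>\<infinity>n. - (x ^ M) * (edge (2 * t - 1 - m) n / ?d n + edge m n / ?d n)) =
     - (x ^ M) * ((\<Sum>\<^sub>\<infinity>n. edge (2 * t - 1 - m) n / ?d n) + (\<Sum>\<^sub>\<infinity>n. edge m n / ?d n))"
    by (simp only: infsum_cmult_right' infsum_add[OF appell_summable[OF edge_summable x] appell_summable[OF edge_summable x]])
  finally show ?thesis by simp
qed

text \<open>The terms in \<open>g(x)\<close> cancel by the quasi-periodicity of \<open>\<Theta>\<close>. The two boundary sums contribute
  \<open>x\<^bsup>2t-1-m\<^esup>\<close> and \<open>x\<^sup>m\<close> times a bounded function; \<open>1 \<le> m < t\<close> puts both exponents between \<open>1\<close> and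
  \<open>2 t - 1\<close>.\<close>

lemma f_functional_equation:
  obtains C where "\<And>x. x \<noteq> 0 \<Longrightarrow> x \<notin> qlattice \<Longrightarrow>
    norm (f_raw \<tau> t m (Q 1 * x) + x ^ (M - 1) * f_raw \<tau> t m x
      + Theta x (Q 1) / (x * qpoch (Q 1) (Q 1) ^ 3) * (\<Sum>i<M. x ^ i * \<Phi> (int i - 2 * t)))
    \<le> C * (norm x + norm x ^ (M - 1))"
proof -
  define P where "P = qpoch (Q 1) (Q 1) ^ 3"
  have P: "P \<noteq> 0" using qpoch_self_nonzero norm_Q1 by (simp add: P_def)
  define L where "L x = Theta x (Q 1) * (\<Sum>\<^sub>\<infinity>n. edge 0 n / (1 - x * Q (of_int n)))" for x
  obtain C where C: "\<And>x. x \<noteq> 0 \<Longrightarrow> x \<notin> qlattice \<Longrightarrow> norm (L x) \<le> C"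
    using Theta_edge_appell_bounded unfolding L_def by blast
  define a where "a = nat m"
  define b where "b = nat (2 * t - 1 - m)"
  have ab: "int a = m" "int b = 2 * t - 1 - m" "1 \<le> a" "a \<le> M - 1" "1 \<le> b" "b \<le> M - 1" "M = Suc (a + b)"
    using t2 m1 mt by (auto simp: a_def b_def M_def)
  have "norm (f_raw \<tau> t m (Q 1 * x) + x ^ (M - 1) * f_raw \<tau> t m x
      + Theta x (Q 1) / (x * P) * (\<Sum>i<M. x ^ i * \<Phi> (int i - 2 * t)))
    \<le> 2 * C / norm P * (norm x + norm x ^ (M - 1))" if x: "x \<noteq> 0" "x \<notin> qlattice" for x
  proof -
    define S where "S = (\<Sum>i<M. x ^ i * \<Phi> (int i - 2 * t))"
    define G where "G = g_fun \<tau> t m x"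
    define E where "E k = (\<Sum>\<^sub>\<infinity>n. edge k n / (1 - x * Q (of_int n)))" for k
    define T where "T = Theta x (Q 1)"
    have E: "x ^ k * E (int k) = E 0" for k unfolding E_def by (rule edge_appell_power[OF x])
    have g: "g_fun \<tau> t m (Q 1 * x) = S + x ^ M * G - x ^ M * (E (int b) + E (int a))"
      unfolding S_def G_def E_def ab(1,2) by (rule g_functional_equation[OF x])
    have "f_raw \<tau> t m (Q 1 * x) + x ^ (M - 1) * f_raw \<tau> t m x + T / (x * P) * S
       = - T / x / P * (S + x ^ M * G - x ^ M * (E (int b) + E (int a))) + x ^ (M - 1) * (T / P * G) + T / (x * P) * S"
      unfolding f_raw_def Theta_shift[OF x(1)] g by (simp add: P_def T_def G_def)
    also have "\<dots> = T / P * (x ^ a * (x ^ b * E (int b)) + x ^ b * (x ^ a * E (int a)))"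
      using P x unfolding ab(7) by (simp add: field_simps power_add)
    also have "\<dots> = (x ^ a + x ^ b) * L x / P"
      unfolding E by (simp add: L_def E_def T_def algebra_simps add_divide_distrib)
    finally have "norm (f_raw \<tau> t m (Q 1 * x) + x ^ (M - 1) * f_raw \<tau> t m x + T / (x * P) * S)
       = norm (x ^ a + x ^ b) * norm (L x) / norm P" by (simp add: norm_mult norm_divide)
    also have "\<dots> \<le> (2 * (norm x + norm x ^ (M - 1))) * C / norm P"
    proof (intro divide_right_mono mult_mono C x)
      have "norm (x ^ a + x ^ b) \<le> norm x ^ a + norm x ^ b"
        by (metis norm_power norm_triangle_ineq)
      also have "\<dots> \<le> (norm x + norm x ^ (M - 1)) + (norm x + norm x ^ (M - 1))"
        using ab by (intro add_mono power_le_ends) auto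
      finally show "norm (x ^ a + x ^ b) \<le> 2 * (norm x + norm x ^ (M - 1))" by simp
    qed auto
    finally show ?thesis unfolding T_def S_def by (simp add: mult_ac)
  qed
  then show ?thesis using that unfolding P_def by blast
qed

section \<open>The theta-weighted double sum\<close>

text \<open>The coefficient of the residue class of \<open>l\<close> on the right-hand side of the theorem, apart from
  \<open>1 / (q)\<^sub>\<infinity>\<^sup>3\<close>, as a function of all integers \<open>l\<close>.\<close>

definition \<psi> :: "int \<Rightarrow> complex" where
  "\<psi> l = (- 1) powi l * Q ((of_int l)\<^sup>2 / (4 * of_int t) + of_int l / 2) * \<Phi> l"

lemma \<psi>_periodic: "\<psi> (l + 2 * t) = \<psi> l"
proof -
  have "(- 1 :: complex) powi (l + 2 * t) = (- 1) powi l" by (simp add: power_int_minus_left)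
  moreover have "(of_int (l + 2 * t))\<^sup>2 / (4 * of_int t) + of_int (l + 2 * t) / 2 =
     ((of_int l)\<^sup>2 / (4 * of_int t) + of_int l / 2) + (of_int (l + 2 * t) :: real)"
    using t2 by (simp add: power2_eq_square field_simps)
  ultimately show ?thesis unfolding \<psi>_def by (subst (2) \<Phi>_shift) (simp only: qpow_add mult.assoc)
qed

lemma \<psi>_cong: "[l = k] (mod (2 * t)) \<Longrightarrow> \<psi> l = \<psi> k"
proof -
  assume "[l = k] (mod (2 * t))"
  then obtain d where d: "l = k + 2 * t * d"
    by (metis cong_iff_lin cong_sym)
  have "\<psi> (k + 2 * t * d) = \<psi> k"
  proof (induction d rule: int_induct[where k = 0])
    case (step1 i)
    have "k + 2 * t * (i + 1) = (k + 2 * t * i) + 2 * t" by (simp add: algebra_simps)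
    then show ?case by (simp only: \<psi>_periodic step1)
  next
    case (step2 i)
    have "k + 2 * t * i = (k + 2 * t * (i - 1)) + 2 * t" by (simp add: algebra_simps)
    then show ?case using \<psi>_periodic[of "k + 2 * t * (i - 1)"] step2 by (simp only:)
  qed simp
  then show ?thesis by (simp add: d)
qed

lemma \<psi>_bounded: obtains \<Psi> where "\<And>l. norm (\<psi> l) \<le> \<Psi>"
proof -
  have "norm (\<psi> l) \<le> (\<Sum>k\<in>{0..<2 * t}. norm (\<psi> k))" for l
  proof -
    have "\<psi> l = \<psi> (l mod (2 * t))" by (rule \<psi>_cong) (simp add: cong_def)
    moreover have "l mod (2 * t) \<in> {0..<2 * t}" using t2 by simp
    ultimately show ?thesis using member_le_sum[of "l mod (2 * t)" "{0..<2 * t}" "\<lambda>k. norm (\<psi> k)"] by simp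
  qed
  then show ?thesis using that by blast
qed

definition weight :: "int \<Rightarrow> int \<Rightarrow> complex" where
  "weight r l = (- 1) powi r * Q ((of_int r)\<^sup>2 / 2 + of_int r * of_int l
     + (2 * of_int t - 1) / (4 * of_int t) * (of_int l)\<^sup>2 + of_int r / 2)"

definition weighted_term :: "complex \<Rightarrow> int \<Rightarrow> int \<Rightarrow> complex" where
  "weighted_term x r l = \<psi> l * (weight r l * x powi (- r))"

text \<open>A region that contains the cone of summation and the two strips by which the cone and its
  translate differ; on it the mixed term \<open>r l\<close> of the exponent is bounded below by a linear form.\<close>

definition admissible :: "int \<Rightarrow> int \<Rightarrow> bool" where
  "admissible r l \<longleftrightarrow> - (2 * t * (\<bar>r\<bar> + \<bar>l\<bar>)) \<le> r * l"

lemma weight_bound: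
  assumes "admissible r l"
  shows "norm (weight r l) \<le> exp (- (rate / 4) * ((of_int r)\<^sup>2 + (of_int l)\<^sup>2) + 3 * rate * of_int t * (\<bar>of_int r\<bar> + \<bar>of_int l\<bar>))"
proof -
  define r' l' t' :: real where "r' = of_int r" and "l' = of_int l" and "t' = of_int t"
  have t': "t' \<ge> 2" using t2 by (simp add: t'_def)
  have "real_of_int (- (2 * t * (\<bar>r\<bar> + \<bar>l\<bar>))) \<le> of_int (r * l)"
    using assms unfolding admissible_def of_int_le_iff .
  then have rl: "- (2 * t' * (\<bar>r'\<bar> + \<bar>l'\<bar>)) \<le> r' * l'" by (simp add: r'_def l'_def t'_def)
  define c where "c = (2 * t' - 1) / (4 * t')"
  define X where "X = r'\<^sup>2 / 2 + r' * l' + c * l'\<^sup>2 + r' / 2"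
  have "1 / 4 \<le> c" using t' by (simp add: c_def field_simps)
  then have "1 / 4 * l'\<^sup>2 \<le> c * l'\<^sup>2" by (rule mult_right_mono) simp
  moreover have "0 \<le> r'\<^sup>2" by simp
  moreover have "\<bar>r'\<bar> \<le> t' * \<bar>r'\<bar>" "0 \<le> t' * \<bar>l'\<bar>" using t' by (simp_all add: mult_le_cancel_right1)
  then have "- (r' / 2) \<le> t' * (\<bar>r'\<bar> + \<bar>l'\<bar>)" by (simp add: distrib_left)
  ultimately have "- X \<le> - (1 / 4) * (r'\<^sup>2 + l'\<^sup>2) + 3 * t' * (\<bar>r'\<bar> + \<bar>l'\<bar>)"
    using rl unfolding X_def distrib_left mult.assoc by linarith
  then have "rate * - X \<le> rate * (- (1 / 4) * (r'\<^sup>2 + l'\<^sup>2) + 3 * t' * (\<bar>r'\<bar> + \<bar>l'\<bar>))"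
    using rate_pos by (intro mult_left_mono) auto
  also have "\<dots> = - (rate / 4) * (r'\<^sup>2 + l'\<^sup>2) + 3 * rate * t' * (\<bar>r'\<bar> + \<bar>l'\<bar>)"
    by (simp add: algebra_simps)
  finally have "rate * - X \<le> - (rate / 4) * (r'\<^sup>2 + l'\<^sup>2) + 3 * rate * t' * (\<bar>r'\<bar> + \<bar>l'\<bar>)" .
  moreover have "weight r l = (- 1) powi r * Q X"
    by (simp add: weight_def X_def c_def r'_def l'_def t'_def)
  then have "norm (weight r l) = exp (rate * - X)" by (simp add: norm_mult norm_power_int norm_qpow)
  ultimately show ?thesis by (simp add: r'_def l'_def t'_def)
qed

lemma weighted_term_bound:
  assumes z: "z \<noteq> 0"
  obtains C b where "\<And>w k r l. w \<in> cball z (norm z / 2) \<Longrightarrow> norm k \<le> 1 \<Longrightarrow> (k \<noteq> 0 \<Longrightarrow> admissible r l) \<Longrightarrow>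
    norm (k * weighted_term w r l) \<le> C * exp (- (rate / 4) * ((of_int r)\<^sup>2 + (of_int l)\<^sup>2) + b * (\<bar>of_int r\<bar> + \<bar>of_int l\<bar>))"
proof -
  obtain \<Psi> where \<Psi>: "\<And>l. norm (\<psi> l) \<le> \<Psi>" using \<psi>_bounded by blast
  have \<Psi>0: "0 \<le> \<Psi>" using order_trans[OF norm_ge_zero \<Psi>[of 0]] .
  define \<rho> where "\<rho> = \<bar>ln (norm z)\<bar> + ln 2"
  have \<rho>: "\<rho> \<ge> 0" by (simp add: \<rho>_def)
  define b where "b = 3 * rate * of_int t + \<rho>"
  have "norm (k * weighted_term w r l) \<le> \<Psi> * exp (- (rate / 4) * ((of_int r)\<^sup>2 + (of_int l)\<^sup>2) + b * (\<bar>of_int r\<bar> + \<bar>of_int l\<bar>))"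
    if w: "w \<in> cball z (norm z / 2)" and k: "norm k \<le> 1" and adm: "k \<noteq> 0 \<Longrightarrow> admissible r l" for w k r l
  proof (cases "k = 0")
    case False
    have wr: "norm (w powi (- r)) \<le> exp (\<rho> * (\<bar>of_int r\<bar> + \<bar>of_int l\<bar>))"
    proof (rule order_trans[OF norm_powi_le_exp(2)[OF z w]])
      show "exp (\<bar>of_int (- r)\<bar> * (\<bar>ln (norm z)\<bar> + ln 2)) \<le> exp (\<rho> * (\<bar>of_int r\<bar> + \<bar>of_int l\<bar>))"
        using \<rho> by (simp add: \<rho>_def[symmetric] mult.commute mult_left_mono)
    qed
    have "norm (k * weighted_term w r l) \<le> 1 * (\<Psi> * (exp (- (rate / 4) * ((of_int r)\<^sup>2 + (of_int l)\<^sup>2) + 3 * rate * of_int t * (\<bar>of_int r\<bar> + \<bar>of_int l\<bar>))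
        * exp (\<rho> * (\<bar>of_int r\<bar> + \<bar>of_int l\<bar>))))"
      unfolding weighted_term_def norm_mult
      by (rule mult_mono[OF k mult_mono[OF \<Psi> mult_mono[OF weight_bound[OF adm[OF False]] wr]]]) (use \<Psi>0 in auto)
    also have "\<dots> = \<Psi> * exp (- (rate / 4) * ((of_int r)\<^sup>2 + (of_int l)\<^sup>2) + b * (\<bar>of_int r\<bar> + \<bar>of_int l\<bar>))"
      by (simp add: exp_add[symmetric] b_def algebra_simps)
    finally show ?thesis .
  qed (use \<Psi>0 in simp)
  then show ?thesis using that by blast
qed

lemma gauss_majorant_summable:
  "(\<lambda>(r::int, l::int). C * exp (- (rate / 4) * ((of_int r)\<^sup>2 + (of_int l)\<^sup>2) + b * (\<bar>of_int r\<bar> + \<bar>of_int l\<bar>))) summable_on UNIV"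
proof -
  have "(\<lambda>x. C * (case x of (r::int, l::int) \<Rightarrow> exp (- (rate / 4) * ((of_int r)\<^sup>2 + (of_int l)\<^sup>2) + b * (\<bar>of_int r\<bar> + \<bar>of_int l\<bar>)))) summable_on UNIV"
    using rate_pos by (intro summable_on_cmult_right summable_on_gauss2) simp
  then show ?thesis by (simp add: case_prod_unfold)
qed

lemma weighted_term_summable:
  assumes "x \<noteq> 0" and "\<And>r l. norm (k r l) \<le> 1" and "\<And>r l. k r l \<noteq> 0 \<Longrightarrow> admissible r l"
  shows "(\<lambda>(r, l). k r l * weighted_term x r l) summable_on UNIV"
proof -
  obtain C b where Cb: "\<And>w k r l. w \<in> cball x (norm x / 2) \<Longrightarrow> norm k \<le> 1 \<Longrightarrow> (k \<noteq> 0 \<Longrightarrow> admissible r l) \<Longrightarrow>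
    norm (k * weighted_term w r l) \<le> C * exp (- (rate / 4) * ((of_int r)\<^sup>2 + (of_int l)\<^sup>2) + b * (\<bar>of_int r\<bar> + \<bar>of_int l\<bar>))"
    using weighted_term_bound[OF assms(1)] by blast
  show ?thesis
    by (rule summable_on_boundedI[OF gauss_majorant_summable[of C b]]) (use Cb[of x] assms(2,3) in \<open>auto simp: case_prod_unfold\<close>)
qed

lemma admissible_same_sign: "sg2 r l \<noteq> 0 \<Longrightarrow> admissible r l"
proof -
  assume "sg2 r l \<noteq> 0"
  then have "0 \<le> r * l" by (auto simp: sg2_def sg_def mult_nonneg_nonneg mult_nonpos_nonpos split: if_splits)
  moreover have "0 \<le> 2 * t * (\<bar>r\<bar> + \<bar>l\<bar>)" using t2 by simp
  ultimately show ?thesis unfolding admissible_def by linarith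
qed

lemma admissible_r_strip: "\<bar>r\<bar> \<le> 2 * t \<Longrightarrow> admissible r l"
proof -
  assume "\<bar>r\<bar> \<le> 2 * t"
  then have "\<bar>r\<bar> * \<bar>l\<bar> \<le> 2 * t * \<bar>l\<bar>" by (rule mult_right_mono) simp
  moreover have "0 \<le> 2 * t * \<bar>r\<bar>" using t2 by simp
  moreover have "- (\<bar>r\<bar> * \<bar>l\<bar>) \<le> r * l" by (metis abs_ge_minus_self abs_mult minus_le_iff)
  ultimately show ?thesis unfolding admissible_def distrib_left by linarith
qed

lemma admissible_l_strip: "\<bar>l\<bar> \<le> 2 * t \<Longrightarrow> admissible r l"
  using admissible_r_strip[of l r] unfolding admissible_def by (simp add: algebra_simps)

lemma norm_sg2: "norm (sg2 r l) \<le> 1"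
  by (simp add: sg2_def sg_def)

definition weighted_sum :: "complex \<Rightarrow> complex" where
  "weighted_sum x = (\<Sum>\<^sub>\<infinity>(r, l). sg2 r l * weighted_term x r l)"

lemma weighted_sum_summable: "x \<noteq> 0 \<Longrightarrow> (\<lambda>(r, l). sg2 r l * weighted_term x r l) summable_on UNIV"
  by (rule weighted_term_summable[OF _ norm_sg2 admissible_same_sign])

lemma weighted_sum_holomorphic: "weighted_sum holomorphic_on - {0}"
proof -
  have "(\<lambda>x. \<Sum>\<^sub>\<infinity>p\<in>UNIV. case p of (r, l) \<Rightarrow> sg2 r l * weighted_term x r l) holomorphic_on - {0}"
  proof (rule holomorphic_on_infsum)
    show "(\<lambda>x. case p of (r, l) \<Rightarrow> sg2 r l * weighted_term x r l) holomorphic_on - {0}" for p :: "int \<times> int"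
      unfolding weighted_term_def case_prod_unfold by (auto intro!: holomorphic_intros)
    fix z :: complex assume "z \<in> - {0}"
    then have z: "z \<noteq> 0" by simp
    obtain C b where Cb: "\<And>w k r l. w \<in> cball z (norm z / 2) \<Longrightarrow> norm k \<le> 1 \<Longrightarrow> (k \<noteq> 0 \<Longrightarrow> admissible r l) \<Longrightarrow>
      norm (k * weighted_term w r l) \<le> C * exp (- (rate / 4) * ((of_int r)\<^sup>2 + (of_int l)\<^sup>2) + b * (\<bar>of_int r\<bar> + \<bar>of_int l\<bar>))"
      using weighted_term_bound[OF z] by blast
    show "\<exists>r>0. \<exists>M. cball z r \<subseteq> - {0} \<and> M summable_on UNIV \<and>
      (\<forall>w\<in>cball z r. \<forall>p\<in>UNIV. norm (case p of (r, l) \<Rightarrow> sg2 r l * weighted_term w r l) \<le> M p)"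
    proof (intro exI conjI ballI)
      show "norm z / 2 > 0" using z by simp
      show "cball z (norm z / 2) \<subseteq> - {0}" using norm_powi_le_exp(1)[OF z] by blast
      show "(\<lambda>(r::int, l::int). C * exp (- (rate / 4) * ((of_int r)\<^sup>2 + (of_int l)\<^sup>2) + b * (\<bar>of_int r\<bar> + \<bar>of_int l\<bar>))) summable_on UNIV"
        by (rule gauss_majorant_summable)
      show "norm (case p of (r, l) \<Rightarrow> sg2 r l * weighted_term w r l) \<le>
         (case p of (r, l) \<Rightarrow> C * exp (- (rate / 4) * ((of_int r)\<^sup>2 + (of_int l)\<^sup>2) + b * (\<bar>of_int r\<bar> + \<bar>of_int l\<bar>)))"
        if "w \<in> cball z (norm z / 2)" for w and p :: "int \<times> int"
        unfolding case_prod_unfold by (rule Cb[OF that norm_sg2 admissible_same_sign])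
    qed
  qed
  then show ?thesis by (simp add: weighted_sum_def[abs_def])
qed

text \<open>The vector \<open>(2 t - 1, - 2 t)\<close> is chosen so that translation by it changes the exponent by \<open>- r\<close>
  exactly, without a term in \<open>l\<close>.\<close>

lemma weighted_term_shift:
  assumes "x \<noteq> 0"
  shows "weighted_term (Q 1 * x) r l = - (x ^ (M - 1)) * weighted_term x (r + (2 * t - 1)) (l - 2 * t)"
proof -
  have t0: "real_of_int t \<noteq> 0" using t2 by simp
  have p: "\<psi> (l - 2 * t) = \<psi> l" using \<psi>_periodic[of "l - 2 * t"] by simp
  have s: "(- 1 :: complex) powi (r + (2 * t - 1)) = - ((- 1) powi r)" by (simp add: power_int_minus_left)
  have xp: "x ^ (M - 1) * x powi (- (r + (2 * t - 1))) = x powi (- r)"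
  proof -
    have "x ^ (M - 1) = x powi (2 * t - 1)" using t2 by (simp add: M_def power_int_def nat_diff_distrib)
    then show ?thesis using assms by (simp flip: power_int_add)
  qed
  have q: "(Q 1 * x) powi (- r) = Q (- of_int r) * x powi (- r)"
    by (simp add: power_int_mult_distrib qpow_powi)
  have e: "(of_int (r + (2 * t - 1)))\<^sup>2 / 2 + of_int (r + (2 * t - 1)) * of_int (l - 2 * t)
     + (2 * of_int t - 1) / (4 * of_int t) * (of_int (l - 2 * t))\<^sup>2 + of_int (r + (2 * t - 1)) / 2
    = ((of_int r)\<^sup>2 / 2 + of_int r * of_int l
     + (2 * of_int t - 1) / (4 * of_int t) * (of_int l)\<^sup>2 + of_int r / 2) + (- of_int r :: real)"
    using t0 by (simp add: power2_eq_square field_simps)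
  have "weight (r + (2 * t - 1)) (l - 2 * t) = - (weight r l * Q (- of_int r))"
    unfolding weight_def s e qpow_add by (simp add: mult_ac)
  then show ?thesis unfolding weighted_term_def p q by (simp add: mult_ac flip: xp)
qed

text \<open>In \<open>n = - r - l\<close> the mixed term disappears from the exponent and the theta series remains.\<close>

lemma weighted_term_theta:
  assumes "x \<noteq> 0"
  shows "(\<Sum>\<^sub>\<infinity>r. weighted_term x r l) = \<Phi> l * x powi l * Theta x (Q 1)"
proof -
  have t0: "real_of_int t \<noteq> 0" using t2 by simp
  have "(\<Sum>\<^sub>\<infinity>r. weighted_term x r l) = (\<Sum>\<^sub>\<infinity>n. \<Phi> l * x powi l * jacobi_term x n)"
  proof (rule infsum_reindex_bij_witness[of _ "\<lambda>n. - n - l" "\<lambda>r. - r - l"])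
    fix r :: int
    define n where "n = - r - l"
    have r: "r = - n - l" by (simp add: n_def)
    have e: "((of_int l)\<^sup>2 / (4 * of_int t) + of_int l / 2) + ((of_int r)\<^sup>2 / 2 + of_int r * of_int l
     + (2 * of_int t - 1) / (4 * of_int t) * (of_int l)\<^sup>2 + of_int r / 2) = ((of_int n)\<^sup>2 - of_int n :: real) / 2"
      using t0 unfolding r by (simp add: power2_eq_square field_simps)
    have s: "(- 1 :: complex) powi l * (- 1) powi r = (- 1) powi n"
      unfolding r by (simp add: power_int_minus_left)
    have xr: "x powi (- r) = x powi l * x powi n"
      using assms unfolding r by (simp flip: power_int_add)
    have j: "(- x) powi n = (- 1) powi n * x powi n"
      unfolding power_int_mult_distrib[symmetric] by simp
    have "weighted_term x r l = \<Phi> l * x powi l * ((((- 1) powi l * (- 1) powi r) * x powi n) *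
      (Q ((of_int l)\<^sup>2 / (4 * of_int t) + of_int l / 2) * Q ((of_int r)\<^sup>2 / 2 + of_int r * of_int l
     + (2 * of_int t - 1) / (4 * of_int t) * (of_int l)\<^sup>2 + of_int r / 2)))"
      unfolding weighted_term_def weight_def \<psi>_def xr by (simp only: mult_ac)
    also have "\<dots> = \<Phi> l * x powi l * jacobi_term x n"
      unfolding s qpow_add[symmetric] e jacobi_term_def j by (simp only: mult_ac)
    finally show "\<Phi> l * x powi l * jacobi_term x (- r - l) = weighted_term x r l" by (simp add: n_def)
  qed auto
  also have "\<dots> = \<Phi> l * x powi l * Theta x (Q 1)"
    unfolding Jacobi_triple_product[OF assms] by (rule infsum_cmult_right')
  finally show ?thesis .
qed

text \<open>The cone and its translate differ by the strips \<open>0 \<le> r < N\<close> and \<open>- 2 t \<le> l < 0\<close>, whose indicator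
  functions are \<open>d1\<close> and \<open>d2\<close>. A fixed \<open>r\<close> in the first strip contributes a multiple of \<open>x\<^bsup>N-r\<^esup>\<close>; a
  fixed \<open>l\<close> in the second contributes a theta function.\<close>

lemma weighted_sum_functional_equation:
  obtains C where "\<And>x. x \<noteq> 0 \<Longrightarrow>
    norm (weighted_sum (Q 1 * x) + x ^ (M - 1) * weighted_sum x + Theta x (Q 1) / x * (\<Sum>i<M. x ^ i * \<Phi> (int i - 2 * t)))
    \<le> C * (norm x + norm x ^ (M - 1))"
proof -
  define N where "N = M - 1"
  have N: "int N = 2 * t - 1" "M = Suc N" using t2 by (simp_all add: N_def M_def)
  define K where "K r = (\<Sum>\<^sub>\<infinity>l. \<psi> l * weight r l)" for r
  define R where "R = {0..<int N}"
  define S where "S = {- 2 * t..<0}"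
  define d1 where "d1 = (\<lambda>(r::int) (l::int). if r \<in> R then 1 else 0 :: complex)"
  define d2 where "d2 = (\<lambda>(r::int) (l::int). if l \<in> S then 1 else 0 :: complex)"
  define C where "C = (\<Sum>r\<in>R. norm (K r))"
  have "norm (weighted_sum (Q 1 * x) + x ^ N * weighted_sum x + Theta x (Q 1) / x * (\<Sum>i<M. x ^ i * \<Phi> (int i - 2 * t)))
     \<le> C * (norm x + norm x ^ N)" if x: "x \<noteq> 0" for x
  proof -
    have sum1: "(\<lambda>(r, l). d1 r l * weighted_term x r l) summable_on UNIV"
      by (rule weighted_term_summable[OF x])
        (auto simp: d1_def R_def N intro!: admissible_r_strip split: if_splits)
    have sum2: "(\<lambda>(r, l). d2 r l * weighted_term x r l) summable_on UNIV"
      by (rule weighted_term_summable[OF x])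
        (auto simp: d2_def S_def intro!: admissible_l_strip split: if_splits)
    have sg: "sg2 (r - int N) (l + 2 * t) = sg2 r l + (- d1 r l + d2 r l)" for r l
      using t2 by (auto simp: sg2_def sg_def d1_def d2_def R_def S_def N)
    have us: "weighted_term (Q 1 * x) r l = - (x ^ N) * weighted_term x (r + int N) (l - 2 * t)" for r l
      using weighted_term_shift[OF x, of r l] unfolding N(1) by (simp only: N_def)
    have "weighted_sum (Q 1 * x) = (\<Sum>\<^sub>\<infinity>(r, l). - (x ^ N) * (sg2 (r - int N) (l + 2 * t) * weighted_term x r l))"
      unfolding weighted_sum_def
    proof (rule infsum_reindex_bij_witness[of _ "\<lambda>(r, l). (r - int N, l + 2 * t)" "\<lambda>(r, l). (r + int N, l - 2 * t)"])
      fix a :: "int \<times> int"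
      show "(case (case a of (r, l) \<Rightarrow> (r + int N, l - 2 * t)) of (r, l) \<Rightarrow> - (x ^ N) * (sg2 (r - int N) (l + 2 * t) * weighted_term x r l))
        = (case a of (r, l) \<Rightarrow> sg2 r l * weighted_term (Q 1 * x) r l)"
        by (cases a) (simp only: prod.case us, simp add: mult_ac)
    qed auto
    also have "\<dots> = - (x ^ N) * (\<Sum>\<^sub>\<infinity>(r, l). sg2 (r - int N) (l + 2 * t) * weighted_term x r l)"
      unfolding infsum_cmult_right'[symmetric] by (simp only: case_prod_unfold)
    also have "(\<Sum>\<^sub>\<infinity>(r, l). sg2 (r - int N) (l + 2 * t) * weighted_term x r l) =
       (\<Sum>\<^sub>\<infinity>p. (case p of (r, l) \<Rightarrow> sg2 r l * weighted_term x r l) + (- (case p of (r, l) \<Rightarrow> d1 r l * weighted_term x r l) + (case p of (r, l) \<Rightarrow> d2 r l * weighted_term x r l)))"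
      unfolding sg by (rule infsum_cong) (auto simp: algebra_simps)
    also have "\<dots> = weighted_sum x + (- (\<Sum>\<^sub>\<infinity>(r, l). d1 r l * weighted_term x r l) + (\<Sum>\<^sub>\<infinity>(r, l). d2 r l * weighted_term x r l))"
      unfolding weighted_sum_def
      by (subst infsum_add, rule weighted_sum_summable[OF x], intro summable_on_add summable_on_uminus[THEN iffD2] sum1 sum2,
          subst infsum_add, intro summable_on_uminus[THEN iffD2] sum1, rule sum2, simp only: infsum_uminus)
    also have "(\<Sum>\<^sub>\<infinity>(r, l). d1 r l * weighted_term x r l) = (\<Sum>r\<in>R. x powi (- r) * K r)"
    proof -
      have "(\<Sum>\<^sub>\<infinity>(r, l). d1 r l * weighted_term x r l) = (\<Sum>r\<in>R. \<Sum>\<^sub>\<infinity>l. case (r, l) of (r, l) \<Rightarrow> d1 r l * weighted_term x r l)"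
        by (rule infsum_strip[OF sum1]) (auto simp: R_def d1_def)
      also have "\<dots> = (\<Sum>r\<in>R. x powi (- r) * K r)"
        unfolding K_def infsum_cmult_right'[symmetric]
        by (intro sum.cong refl infsum_cong) (simp add: d1_def weighted_term_def mult_ac)
      finally show ?thesis .
    qed
    also have "(\<Sum>\<^sub>\<infinity>(r, l). d2 r l * weighted_term x r l) = (\<Sum>l\<in>S. \<Phi> l * x powi l * Theta x (Q 1))"
    proof -
      have bij: "bij_betw (\<lambda>(l::int, r::int). (r, l)) UNIV UNIV"
        by (rule bij_betwI[of _ _ _ "\<lambda>(r, l). (l, r)"]) auto
      have "(\<lambda>p. (case (case p of (l, r) \<Rightarrow> (r, l)) of (r, l) \<Rightarrow> d2 r l * weighted_term x r l)) summable_on UNIV"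
        using sum2 summable_on_reindex_bij_betw[OF bij] by blast
      then have sum2': "(\<lambda>(l, r). d2 r l * weighted_term x r l) summable_on UNIV"
        by (simp add: case_prod_unfold)
      have "(\<Sum>\<^sub>\<infinity>(r, l). d2 r l * weighted_term x r l) = (\<Sum>\<^sub>\<infinity>(l, r). d2 r l * weighted_term x r l)"
        by (rule infsum_reindex_bij_witness[of _ "\<lambda>(r, l). (l, r)" "\<lambda>(l, r). (r, l)"]) auto
      also have "\<dots> = (\<Sum>l\<in>S. \<Sum>\<^sub>\<infinity>r. case (l, r) of (l, r) \<Rightarrow> d2 r l * weighted_term x r l)"
        by (rule infsum_strip[OF sum2']) (auto simp: S_def d2_def)
      also have "\<dots> = (\<Sum>l\<in>S. \<Phi> l * x powi l * Theta x (Q 1))"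
        unfolding weighted_term_theta[OF x, symmetric]
        by (intro sum.cong refl infsum_cong) (simp add: d2_def)
      finally show ?thesis .
    qed
    also have "(\<Sum>l\<in>S. \<Phi> l * x powi l * Theta x (Q 1)) = (\<Sum>i<M. \<Phi> (int i - 2 * t) * x powi (int i - 2 * t) * Theta x (Q 1))"
      by (rule sum.reindex_bij_witness[of _ "\<lambda>i. int i - 2 * t" "\<lambda>l. nat (l + 2 * t)"])
        (use t2 in \<open>auto simp: S_def M_def\<close>)
    finally have main: "weighted_sum (Q 1 * x) = - (x ^ N) * (weighted_sum x + (- (\<Sum>r\<in>R. x powi (- r) * K r)
       + (\<Sum>i<M. \<Phi> (int i - 2 * t) * x powi (int i - 2 * t) * Theta x (Q 1))))" .
    have theta: "x ^ N * (\<Sum>i<M. \<Phi> (int i - 2 * t) * x powi (int i - 2 * t) * Theta x (Q 1)) =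
       Theta x (Q 1) / x * (\<Sum>i<M. x ^ i * \<Phi> (int i - 2 * t))"
      unfolding sum_distrib_left
    proof (rule sum.cong[OF refl])
      fix i
      have "x ^ N * x powi (int i - 2 * t) = x powi (int N + (int i - 2 * t))"
        using x by (simp add: power_int_add)
      also have "int N + (int i - 2 * t) = int i - 1" by (simp add: N(1))
      also have "x powi (int i - 1) = x ^ i / x" using x by (simp add: power_int_diff)
      finally have e: "x ^ N * x powi (int i - 2 * t) = x ^ i / x" .
      have "x ^ N * (\<Phi> (int i - 2 * t) * x powi (int i - 2 * t) * Theta x (Q 1)) =
        (x ^ N * x powi (int i - 2 * t)) * (\<Phi> (int i - 2 * t) * Theta x (Q 1))" by (simp only: mult_ac)
      then show "x ^ N * (\<Phi> (int i - 2 * t) * x powi (int i - 2 * t) * Theta x (Q 1)) = Theta x (Q 1) / x * (x ^ i * \<Phi> (int i - 2 * t))"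
        unfolding e by simp
    qed
    have "weighted_sum (Q 1 * x) + x ^ N * weighted_sum x + Theta x (Q 1) / x * (\<Sum>i<M. x ^ i * \<Phi> (int i - 2 * t))
       = x ^ N * (\<Sum>r\<in>R. x powi (- r) * K r)"
      unfolding main theta[symmetric] by (simp only: distrib_left mult_minus_left mult_minus_right) simp
    also have "\<dots> = (\<Sum>r\<in>R. x ^ N * x powi (- r) * K r)" by (simp add: sum_distrib_left mult.assoc)
    also have "norm \<dots> \<le> (\<Sum>r\<in>R. (norm x + norm x ^ N) * norm (K r))"
    proof (rule sum_norm_le)
      fix r assume r: "r \<in> R"
      have "x ^ N * x powi (- r) = x powi (int N + - r)" using x by (simp add: power_int_add del: add_uminus_conv_diff)
      also have "\<dots> = x ^ nat (int N - r)" using r by (simp add: R_def power_int_def)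
      finally have "norm (x ^ N * x powi (- r)) \<le> norm x + norm x ^ N"
        using r by (simp only: norm_power) (rule power_le_ends, auto simp: R_def)
      then show "norm (x ^ N * x powi (- r) * K r) \<le> (norm x + norm x ^ N) * norm (K r)"
        unfolding norm_mult[of _ "K r"] by (rule mult_right_mono) simp
    qed
    also have "\<dots> = C * (norm x + norm x ^ N)" unfolding C_def sum_distrib_right by (simp only: mult.commute)
    finally show ?thesis .
  qed
  then show ?thesis using that unfolding N_def by blast
qed

lemma finite_residue_system:
  assumes "complete_residue_system (2 * t) K"
  shows "finite K"
proof (rule finite_imageD)
  show "finite ((\<lambda>k. k mod (2 * t)) ` K)"
    by (rule finite_subset[of _ "{0..<2 * t}"]) (use t2 in auto)
  show "inj_on (\<lambda>k. k mod (2 * t)) K"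
    using assms unfolding complete_residue_system_def inj_on_def cong_def by metis
qed

text \<open>Periodicity of \<open>\<psi>\<close> lets the coefficient of a class be evaluated at each of its members, whichever
  representatives \<open>K\<close> contains.\<close>

lemma residue_class_sum:
  assumes K: "complete_residue_system (2 * t) K" and x: "x \<noteq> 0"
  shows "qpow \<tau> (- of_int t / 4) *
    (\<Sum>k\<in>K. (- 1) powi k * qpow \<tau> ((of_int k + of_int t) ^ 2 / (4 * of_int t)) *
       theta \<tau> t (t + k) (m + k) *
       (\<Sum>\<^sub>\<infinity>(r, l) \<in> {(r, l). [l = k] (mod (2 * t))}.
          sg2 r l * (- 1) powi r *
          qpow \<tau> (of_int r ^ 2 / 2 + of_int r * of_int l
                   + (2 * of_int t - 1) / (4 * of_int t) * of_int l ^ 2 + of_int r / 2) *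
          x powi (- r))) = weighted_sum x"
proof -
  let ?v = "\<lambda>(r, l). sg2 r l * weighted_term x r l"
  have t0: "real_of_int t \<noteq> 0" using t2 by simp
  have one: "qpow \<tau> (- of_int t / 4) * ((- 1) powi k * qpow \<tau> ((of_int k + of_int t) ^ 2 / (4 * of_int t)) *
       theta \<tau> t (t + k) (m + k) *
       (\<Sum>\<^sub>\<infinity>(r, l) \<in> {(r, l). [l = k] (mod (2 * t))}.
          sg2 r l * (- 1) powi r *
          qpow \<tau> (of_int r ^ 2 / 2 + of_int r * of_int l
                   + (2 * of_int t - 1) / (4 * of_int t) * of_int l ^ 2 + of_int r / 2) *
          x powi (- r))) = infsum ?v {(r, l). [l = k] (mod (2 * t))}" for k
  proof -
    have "(of_int k)\<^sup>2 / (4 * of_int t) + of_int k / 2 = - of_int t / 4 + (of_int k + of_int t) ^ 2 / (4 * real_of_int t)"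
      using t0 by (simp add: power2_eq_square field_simps)
    then have \<psi>: "\<psi> k = qpow \<tau> (- of_int t / 4) * ((- 1) powi k * qpow \<tau> ((of_int k + of_int t) ^ 2 / (4 * of_int t)) *
       theta \<tau> t (t + k) (m + k))"
      unfolding \<psi>_def theta_eq by (simp only: qpow_add mult_ac)
    have "infsum ?v {(r, l). [l = k] (mod (2 * t))} = (\<Sum>\<^sub>\<infinity>p\<in>{(r, l). [l = k] (mod (2 * t))}. \<psi> k * (case p of (r, l) \<Rightarrow>
          sg2 r l * (- 1) powi r *
          qpow \<tau> (of_int r ^ 2 / 2 + of_int r * of_int l
                   + (2 * of_int t - 1) / (4 * of_int t) * of_int l ^ 2 + of_int r / 2) *
          x powi (- r)))"
    proof (rule infsum_cong)
      fix p :: "int \<times> int" assume "p \<in> {(r, l). [l = k] (mod (2 * t))}"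
      then obtain r l where p: "p = (r, l)" and "[l = k] (mod (2 * t))" by blast
      then have "\<psi> l = \<psi> k" by (intro \<psi>_cong)
      then show "?v p = \<psi> k * (case p of (r, l) \<Rightarrow>
          sg2 r l * (- 1) powi r *
          qpow \<tau> (of_int r ^ 2 / 2 + of_int r * of_int l
                   + (2 * of_int t - 1) / (4 * of_int t) * of_int l ^ 2 + of_int r / 2) *
          x powi (- r))"
        unfolding p prod.case weighted_term_def weight_def by (simp only: mult_ac)
    qed
    then show ?thesis unfolding infsum_cmult_right' \<psi> by (simp only: mult.assoc)
  qed
  have "(\<Sum>k\<in>K. infsum ?v {(r, l). [l = k] (mod (2 * t))}) = infsum ?v (\<Union>k\<in>K. {(r, l). [l = k] (mod (2 * t))})"
  proof (rule sum_infsum[OF finite_residue_system[OF K]])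
    show "?v summable_on {(r, l). [l = k] (mod (2 * t))}" for k
      by (rule summable_on_subset_banach[OF weighted_sum_summable[OF x]]) simp
    show "{(r::int, l). [l = k] (mod (2 * t))} \<inter> {(r, l). [l = k'] (mod (2 * t))} = {}"
      if "k \<in> K" "k' \<in> K" "k \<noteq> k'" for k k'
      using K that unfolding complete_residue_system_def by (auto dest: cong_sym)
  qed
  also have "(\<Union>k\<in>K. {(r::int, l). [l = k] (mod (2 * t))}) = UNIV"
  proof -
    have "\<exists>k\<in>K. [l = k] (mod (2 * t))" for l
      using K unfolding complete_residue_system_def by (meson cong_sym)
    then show ?thesis by auto
  qed
  finally show ?thesis unfolding sum_distrib_left one weighted_sum_def .
qed

section \<open>Comparison of the two functional equations\<close>

text \<open>By definition \<open>f_fun\<close> removes singularities on \<open>qlattice\<close> only; elsewhere \<open>f_raw\<close> is analytic, so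
  \<open>f_fun\<close> coincides with one function from which all singularities have been removed.\<close>

lemma f_fun_holomorphic: "f_fun \<tau> t m holomorphic_on - {0}"
  and f_fun_eq_f_raw: "x \<noteq> 0 \<Longrightarrow> x \<notin> qlattice \<Longrightarrow> f_fun \<tau> t m x = f_raw \<tau> t m x"
proof -
  define P where "P = qpoch (Q 1) (Q 1) ^ 3"
  define h where "h w = Theta w (Q 1) * (\<Sum>\<^sub>\<infinity>n. hcoeff n / P / (1 - w * Q (of_int n)))" for w
  have sum: "(\<lambda>n. hcoeff n / P) summable_on UNIV"
    unfolding divide_inverse by (intro summable_on_cmult_left hcoeff_summable)
  have f: "f_raw \<tau> t m w = h w" if "w \<noteq> 0" for w
  proof -
    have "(\<Sum>\<^sub>\<infinity>n. hcoeff n / P / (1 - w * Q (of_int n))) = (\<Sum>\<^sub>\<infinity>n. hcoeff n / (1 - w * Q (of_int n)) * inverse P)"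
      by (rule infsum_cong) (simp add: field_simps)
    also have "\<dots> = g_fun \<tau> t m w * inverse P"
      unfolding g_eq[OF that] by (rule infsum_cmult_left')
    finally show ?thesis by (simp add: h_def f_raw_def P_def divide_inverse mult_ac)
  qed
  have rs: "remove_sings (f_raw \<tau> t m) z = remove_sings h z" if "z \<noteq> 0" for z
  proof (rule remove_sings_cong)
    have "\<forall>\<^sub>F w in at z. w \<in> - {0}" using that by (intro eventually_at_in_open') auto
    then show "\<forall>\<^sub>F w in at z. f_raw \<tau> t m w = h w" by eventually_elim (simp add: f)
  qed simp
  have ff: "f_fun \<tau> t m z = remove_sings h z" if "z \<noteq> 0" for z
  proof (cases "z \<in> qlattice")
    case True
    then show ?thesis using rs[OF that] by (auto simp: f_fun_def qlattice_def)
  next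
    case False
    then have "f_fun \<tau> t m z = f_raw \<tau> t m z" by (auto simp: f_fun_def qlattice_def)
    moreover have "h analytic_on {z}"
      using Theta_appell_removable(1)[OF sum that False] unfolding h_def[abs_def] .
    ultimately show ?thesis using f[OF that] by simp
  qed
  have "remove_sings h analytic_on - {0}"
    using Theta_appell_removable(2)[OF sum] unfolding h_def[abs_def]
    by (subst analytic_on_analytic_at) auto
  then have "remove_sings h holomorphic_on - {0}" by (rule analytic_imp_holomorphic)
  then show "f_fun \<tau> t m holomorphic_on - {0}"
    by (rule holomorphic_transform) (simp add: ff)
  show "f_fun \<tau> t m x = f_raw \<tau> t m x" if "x \<noteq> 0" "x \<notin> qlattice"
    using that by (auto simp: f_fun_def qlattice_def)
qed

theorem f_fun_eq_weighted_sum: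
  assumes x: "x \<noteq> 0"
  shows "f_fun \<tau> t m x = weighted_sum x / qpoch (Q 1) (Q 1) ^ 3"
proof -
  define P where "P = qpoch (Q 1) (Q 1) ^ 3"
  have P: "P \<noteq> 0" using qpoch_self_nonzero norm_Q1 by (simp add: P_def)
  define N where "N = M - 1"
  define S where "S x = (\<Sum>i<M. x ^ i * \<Phi> (int i - 2 * t))" for x
  define H where "H x = f_fun \<tau> t m x - weighted_sum x / P" for x
  obtain C1 where C1: "\<And>x. x \<noteq> 0 \<Longrightarrow> x \<notin> qlattice \<Longrightarrow>
    norm (f_raw \<tau> t m (Q 1 * x) + x ^ N * f_raw \<tau> t m x + Theta x (Q 1) / (x * P) * S x) \<le> C1 * (norm x + norm x ^ N)"
    using f_functional_equation unfolding N_def P_def S_def by blast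
  obtain C2 where C2: "\<And>x. x \<noteq> 0 \<Longrightarrow>
    norm (weighted_sum (Q 1 * x) + x ^ N * weighted_sum x + Theta x (Q 1) / x * S x) \<le> C2 * (norm x + norm x ^ N)"
    using weighted_sum_functional_equation unfolding N_def S_def by blast
  define C where "C = C1 + C2 / norm P"
  have H: "H holomorphic_on - {0}"
    unfolding H_def by (intro holomorphic_intros f_fun_holomorphic weighted_sum_holomorphic) (use P in auto)
  have contH: "continuous_on (- {0}) H" using H by (rule holomorphic_on_imp_continuous_on)
  have "H x = 0"
  proof (rule q_difference_unique[OF H norm_Q1 _ _ x])
    show "1 \<le> N" using t2 by (simp add: N_def M_def)
    fix x :: complex assume x0: "x \<noteq> 0"
    show "norm (H (Q 1 * x) + x ^ N * H x) \<le> C * (norm x + norm x ^ N)"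
    proof (rule le_extends_over_qlattice[OF _ _ _ x0])
      show "continuous_on (- {0}) (\<lambda>x. norm (H (Q 1 * x) + x ^ N * H x))"
        by (intro continuous_intros contH continuous_on_compose2[OF contH]) auto
      show "continuous_on (- {0}) (\<lambda>x::complex. C * (norm x + norm x ^ N))"
        by (intro continuous_intros)
      fix x assume x: "x \<noteq> 0" "x \<notin> qlattice"
      have "H (Q 1 * x) + x ^ N * H x =
        (f_raw \<tau> t m (Q 1 * x) + x ^ N * f_raw \<tau> t m x + Theta x (Q 1) / (x * P) * S x)
        - (weighted_sum (Q 1 * x) + x ^ N * weighted_sum x + Theta x (Q 1) / x * S x) / P"
        using x P qlattice_shift f_fun_eq_f_raw[of x] f_fun_eq_f_raw[of "Q 1 * x"]
        by (simp add: H_def algebra_simps diff_divide_distrib add_divide_distrib)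
      also have "norm \<dots> \<le> C1 * (norm x + norm x ^ N) + C2 * (norm x + norm x ^ N) / norm P"
        by (rule order_trans[OF norm_triangle_ineq4])
          (simp only: norm_divide, intro add_mono divide_right_mono C1 C2 x norm_ge_zero)
      also have "\<dots> = C * (norm x + norm x ^ N)" by (simp add: C_def algebra_simps add_divide_distrib)
      finally show "norm (H (Q 1 * x) + x ^ N * H x) \<le> C * (norm x + norm x ^ N)" .
    qed
  qed
  then show ?thesis by (simp add: H_def P_def)
qed

end

theorem theorem1p6:
  fixes q \<tau> x :: complex and t m :: int and K :: "int set"
  assumes "0 < norm q" and "norm q < 1"
    and "q = exp (2 * of_real pi * \<i> * \<tau>)"
    and "2 \<le> t" and "1 \<le> m" and "m < t"
    and "complete_residue_system (2 * t) K"
    and "x \<noteq> 0"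
  shows "f_fun \<tau> t m x =
    qpow \<tau> (- of_int t / 4) / qpoch q q ^ 3 *
    (\<Sum>k\<in>K. (- 1) powi k * qpow \<tau> ((of_int k + of_int t) ^ 2 / (4 * of_int t)) *
       theta \<tau> t (t + k) (m + k) *
       (\<Sum>\<^sub>\<infinity>(r, l) \<in> {(r, l). [l = k] (mod (2 * t))}.
          sg2 r l * (- 1) powi r *
          qpow \<tau> (of_int r ^ 2 / 2 + of_int r * of_int l
                   + (2 * of_int t - 1) / (4 * of_int t) * of_int l ^ 2 + of_int r / 2) *
          x powi (- r)))"
proof -
  have q: "q = qpow \<tau> 1" using assms(3) by (simp add: qpow_def)
  then have "Im \<tau> > 0" using assms(2) by (simp add: norm_qpow zero_less_mult_iff)
  then interpret hecke \<tau> t m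
    using assms by unfold_locales
  show ?thesis
    by (simp only: f_fun_eq_weighted_sum[OF assms(8)] residue_class_sum[OF assms(7,8), symmetric] q times_divide_eq_left)
qed

end
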